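(* Let $N\in\mathbb{N}$, $N\ge 1$, let $T>4(2+N^{-1})$ and let $(u^{0,N},u^{1,N})\in \mathbb{P}^{Di}_{N}(\Omega)\times \mathbb{P}^{Di}_{N}(\Omega)$. Then there exist controls $f^N, g^N_L, g^N_R\in L^2(0,T)$ such that the solution $u^N$, with $u^N(t,\cdot)\in\mathbb{P}_N(\Omega)$, of the discrete system $$\begin{cases} (u^{N}_{tt}-u^{N}_{xx})(t,x_{i})= g_{L}^{N}(t)G^{N}_{L}(x_{i})+g_{R}^{N}(t)G^{N}_{R}(x_{i}), & t\in(0,T),\ x_i\in C^{\Omega},\\ u^{N}(t,1)=f^{N}(t), \quad u^{N}(t,-1)=0, & t\in(0,T),\\ u^{N}(0,x_{i})=u^{0,N}(x_i),\quad u_{t}^{N}(0,x_{i})=u^{1,N}(x_i), & x_i\in C^{\Omega}, \end{cases}$$ satisfies $$u^{N}(T,x_{i})=u^{N}_{t}(T,x_{i})=0\quad\text{for all } x_{i}\in C^{\Omega}.$$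
   Context: $\Omega=(-1,1)$. $\mathbb{P}_N(\Omega)$ is the space of polynomials on $\bar\Omega$ of degree at most $N$, and $\mathbb{P}_N^{Di}(\Omega)$ is its subspace of polynomials vanishing at $x=\pm1$. The Legendre-Gauss-Lobatto (LGL) nodes $-1=x_0<x_1<\dots<x_N=1$ are the roots of $(1-x^2)L_N'(x)$, where $L_N$ is the $N$-th Legendre polynomial; $C^\Omega=\{x_1,\dots,x_{N-1}\}$ is the set of interior nodes. $\omega_i$, $0\le i\le N$, are the LGL quadrature weights, so that $\sum_{i=0}^N p(x_i)\omega_i=\int_{-1}^1p\,dx$ for all polynomials $p$ of degree at most $2N-1$; in particular $\omega_0=\omega_N=\frac{2}{N(N+1)}$. $\Psi_i\in\mathbb{P}_N(\Omega)$ is the Lagrange polynomial equal to $1$ at $x_i$ and $0$ at the other nodes. The polynomials $G_L^N,G_R^N\in\mathbb{P}_{N-1}(\Omega)$ are $$G^{N}_{L}=\frac{h^{L}_{xx}}{\sqrt{\omega_{0}}}-\frac{\Psi_{0,x}}{\sqrt{\omega_{0}}\,\omega_{0}},\qquad G^{N}_{R}=\frac{h^{R}_{xx}}{\sqrt{\omega_{N}}}+\frac{\Psi_{N,x}}{\sqrt{\omega_{N}}\,\omega_{N}},$$ where $h^L,h^R\in\mathbb{P}_N^{Di}(\Omega)$ are determined by $h^L(x_i)=\frac{1-x_i}{2}$, $h^R(x_i)=\frac{1+x_i}{2}$ for $x_i\in C^\Omega$. The discrete system is a linear ODE system for the interior nodal values $u^N(t,x_i)$, $x_i\in C^\Omega$,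 forced by $f^N,g_L^N,g_R^N\in L^2(0,T)$, and the solution is understood in this sense. *)

theory Defs
  imports "HOL-Analysis.Analysis" "HOL-Computational_Algebra.Polynomial"
begin

definition polys_upto :: "nat \<Rightarrow> real poly set" where
  "polys_upto N = {p. degree p \<le> N}"

definition polys_upto_Di :: "nat \<Rightarrow> real poly set" where
  "polys_upto_Di N = {p \<in> polys_upto N. poly p (-1) = 0 \<and> poly p 1 = 0}"

(* Rodrigues' formula, normalised by L_N(1) = 1. *)
definition Legendre :: "nat \<Rightarrow> real poly" where
  "Legendre N = smult (1 / (2 ^ N * fact N)) ((pderiv ^^ N) ([:-1, 0, 1:] ^ N))"

(* The nodes are used as a set of reals: for N \<ge> 1 the indices 0 and N of the increasing
   enumeration x_0 < ... < x_N belong to the points -1 and 1, and index sums are sums over nodes. *)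
definition LGL_nodes :: "nat \<Rightarrow> real set" where
  "LGL_nodes N = {x. poly ([:1, 0, -1:] * pderiv (Legendre N)) x = 0}"

definition LGL_interior :: "nat \<Rightarrow> real set" where
  "LGL_interior N = LGL_nodes N - {-1, 1}"

definition LGL_basis :: "nat \<Rightarrow> real \<Rightarrow> real poly" where
  "LGL_basis N \<xi> = (\<Prod>\<eta>\<in>LGL_nodes N - {\<xi>}. smult (1 / (\<xi> - \<eta>)) [:-\<eta>, 1:])"

(* Interpolatory weights: exactness on polys_upto (2 * N - 1), applied to the Lagrange basis,
   forces this value. *)
definition LGL_weight :: "nat \<Rightarrow> real \<Rightarrow> real" where
  "LGL_weight N \<xi> = integral {-1..1} (poly (LGL_basis N \<xi>))"

(* h^L and h^R: the elements of polys_upto_Di N with the values (1 - \<xi>)/2 and (1 + \<xi>)/2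
   at the interior nodes; see hL_interpolates and hR_interpolates. *)
definition hL :: "nat \<Rightarrow> real poly" where
  "hL N = (\<Sum>\<xi>\<in>LGL_interior N. smult ((1 - \<xi>) / 2) (LGL_basis N \<xi>))"

definition hR :: "nat \<Rightarrow> real poly" where
  "hR N = (\<Sum>\<xi>\<in>LGL_interior N. smult ((1 + \<xi>) / 2) (LGL_basis N \<xi>))"

definition GL :: "nat \<Rightarrow> real poly" where
  "GL N = (let \<omega> = LGL_weight N (-1) in
     smult (1 / sqrt \<omega>) (pderiv (pderiv (hL N)))
     - smult (1 / (sqrt \<omega> * \<omega>)) (pderiv (LGL_basis N (-1))))"

definition GR :: "nat \<Rightarrow> real poly" where
  "GR N = (let \<omega> = LGL_weight N 1 in
     smult (1 / sqrt \<omega>) (pderiv (pderiv (hR N)))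
     + smult (1 / (sqrt \<omega> * \<omega>)) (pderiv (LGL_basis N 1)))"

definition L2_fun :: "real \<Rightarrow> (real \<Rightarrow> real) set" where
  "L2_fun T = {f \<in> borel_measurable (lebesgue_on {0<..<T}).
                 integrable (lebesgue_on {0<..<T}) (\<lambda>t. (f t)\<^sup>2)}"

(* Caratheodory solution of the semi-discrete wave equation. Each interior nodal value is
   continuously differentiable on [0,T] and its velocity v is the integral of the right-hand
   side u_xx + gL GL + gR GR, i.e. v is absolutely continuous and the equation holds for almost
   every t. For f, gL, gR in L^2 this right-hand side is Lebesgue integrable, so the gauge
   integral is the Lebesgue integral. Since f is an L^2 function, the boundary conditions are
   required for almost every t. *)
definition is_solution ::
  "nat \<Rightarrow> real \<Rightarrow> (real \<Rightarrow> real) \<Rightarrow> (real \<Rightarrow> real) \<Rightarrow> (real \<Rightarrow> real) \<Rightarrow>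
   real poly \<Rightarrow> real poly \<Rightarrow> (real \<Rightarrow> real poly) \<Rightarrow> bool" where
  "is_solution N T f gL gR u0 u1 u \<longleftrightarrow>
     (\<forall>t\<in>{0..T}. u t \<in> polys_upto N) \<and>
     (AE t in lebesgue_on {0<..<T}. poly (u t) 1 = f t \<and> poly (u t) (-1) = 0) \<and>
     (\<forall>\<xi>\<in>LGL_interior N. poly (u 0) \<xi> = poly u0 \<xi> \<and>
        (\<exists>v. v 0 = poly u1 \<xi> \<and>
             (\<forall>t\<in>{0..T}.
                ((\<lambda>s. poly (u s) \<xi>) has_real_derivative v t) (at t within {0..T}) \<and>
                ((\<lambda>s. poly (pderiv (pderiv (u s))) \<xi>
                       + gL s * poly (GL N) \<xi> + gR s * poly (GR N) \<xi>)
                   has_integral (v t - v 0)) {0..t})))"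

lemma degree_Legendre: "degree (Legendre N) = N"
proof -
  have iter: "degree ((pderiv ^^ k) p) = degree p - k" for k and p :: "real poly"
    by (induction k) (simp_all add: degree_pderiv)
  have "degree ([:-1, 0, 1:] ^ N :: real poly) = 2 * N"
    by (simp add: degree_power_eq)
  then show ?thesis
    by (simp add: Legendre_def iter)
qed

lemma LGL_node_poly:
  assumes "1 \<le> N"
  shows "[:1, 0, -1:] * pderiv (Legendre N) \<noteq> 0"
    and "degree ([:1, 0, -1:] * pderiv (Legendre N)) = N + 1"
proof -
  have nz: "pderiv (Legendre N) \<noteq> 0"
    using assms by (simp add: pderiv_eq_0_iff degree_Legendre)
  then show "[:1, 0, -1:] * pderiv (Legendre N) \<noteq> 0"
    by (simp del: mult_pCons_left)
  have "degree ([:1, 0, -1:] * pderiv (Legendre N)) = 2 + (N - 1)"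
    using nz by (subst degree_mult_eq) (simp_all add: degree_pderiv degree_Legendre)
  then show "degree ([:1, 0, -1:] * pderiv (Legendre N)) = N + 1"
    using assms by linarith
qed

lemma finite_LGL_nodes: "1 \<le> N \<Longrightarrow> finite (LGL_nodes N)"
  unfolding LGL_nodes_def by (rule poly_roots_finite) (rule LGL_node_poly)

lemma card_LGL_nodes_le: "1 \<le> N \<Longrightarrow> card (LGL_nodes N) \<le> N + 1"
  unfolding LGL_nodes_def using card_poly_roots_bound LGL_node_poly by metis

lemma LGL_end_nodes: "-1 \<in> LGL_nodes N" "1 \<in> LGL_nodes N"
  by (simp_all add: LGL_nodes_def)

lemma poly_LGL_basis:
  assumes "1 \<le> N" "\<eta> \<in> LGL_nodes N"
  shows "poly (LGL_basis N \<xi>) \<eta> = (if \<eta> = \<xi> then 1 else 0)"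
  using assms finite_LGL_nodes[OF assms(1)]
  by (auto simp: LGL_basis_def poly_prod intro!: prod.neutral prod_zero bexI[of _ \<eta>]
      simp flip: diff_divide_distrib)

lemma LGL_basis_in:
  assumes "1 \<le> N" "\<xi> \<in> LGL_nodes N"
  shows "LGL_basis N \<xi> \<in> polys_upto N"
proof -
  have "degree (LGL_basis N \<xi>) \<le> (\<Sum>\<eta>\<in>LGL_nodes N - {\<xi>}. 1)"
    unfolding LGL_basis_def
    by (rule order_trans[OF degree_prod_sum_le])
       (auto simp: finite_LGL_nodes[OF assms(1)] intro!: sum_mono order_trans[OF degree_smult_le])
  also have "\<dots> \<le> N"
    using assms card_LGL_nodes_le[OF assms(1)] finite_LGL_nodes[OF assms(1)] by simp
  finally show ?thesis
    by (simp add: polys_upto_def)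
qed

lemma LGL_interpolant:
  assumes N: "1 \<le> N"
  defines "p \<equiv> \<lambda>c. \<Sum>\<xi>\<in>LGL_interior N. smult (c \<xi>) (LGL_basis N \<xi>)"
  shows "p c \<in> polys_upto_Di N" "\<And>\<xi>. \<xi> \<in> LGL_interior N \<Longrightarrow> poly (p c) \<xi> = c \<xi>"
proof -
  have fin: "finite (LGL_interior N)"
    using finite_LGL_nodes[OF N] by (simp add: LGL_interior_def)
  have val: "poly (p c) \<eta> = (if \<eta> \<in> LGL_interior N then c \<eta> else 0)"
    if "\<eta> \<in> LGL_nodes N" for \<eta>
    using that fin by (simp add: p_def poly_sum poly_LGL_basis[OF N] if_distrib cong: if_cong)
  have "degree (p c) \<le> N"
    unfolding p_def
  proof (rule degree_sum_le[OF fin])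
    fix \<xi> assume "\<xi> \<in> LGL_interior N"
    then have "degree (LGL_basis N \<xi>) \<le> N"
      using LGL_basis_in[OF N, of \<xi>] by (simp add: LGL_interior_def polys_upto_def)
    then show "degree (smult (c \<xi>) (LGL_basis N \<xi>)) \<le> N"
      using degree_smult_le order_trans by blast
  qed
  then show "p c \<in> polys_upto_Di N"
    by (simp add: polys_upto_Di_def polys_upto_def val LGL_end_nodes) (simp add: LGL_interior_def)
  show "\<And>\<xi>. \<xi> \<in> LGL_interior N \<Longrightarrow> poly (p c) \<xi> = c \<xi>"
    by (subst val) (auto simp: LGL_interior_def)
qed

lemma hL_interpolates:
  assumes "1 \<le> N"
  shows "hL N \<in> polys_upto_Di N" "\<And>\<xi>. \<xi> \<in> LGL_interior N \<Longrightarrow> poly (hL N) \<xi> = (1 - \<xi>) / 2"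
  unfolding hL_def by (rule LGL_interpolant[OF assms])+

lemma hR_interpolates:
  assumes "1 \<le> N"
  shows "hR N \<in> polys_upto_Di N" "\<And>\<xi>. \<xi> \<in> LGL_interior N \<Longrightarrow> poly (hR N) \<xi> = (1 + \<xi>) / 2"
  unfolding hR_def by (rule LGL_interpolant[OF assms])+

end

theory Submission
  imports Defs
begin

text \<open>The discrete system is a linear system in finite dimension, and the two boundary controls
  \<open>gL\<close>, \<open>gR\<close> with \<open>f = 0\<close> already control it. By exactness of the quadrature, the discrete
  Laplacian is symmetric for the discrete inner product, and the input vectors represent, up to
  nonzero factors, the functionals \<open>q \<mapsto> q''(-1)\<close> and \<open>q \<mapsto> q''(1)\<close>. If \<open>q\<close> annihilates the
  Krylov spaces of both inputs, then \<open>q''\<close> vanishes at the end points, so the discrete Laplacian of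
  \<open>q\<close> is \<open>q''\<close> itself, which annihilates them again; since differentiation lowers the degree,
  \<open>q = 0\<close>. Hence the Krylov spaces span, and each input steers the components in its own Krylov
  space along an explicit trajectory that is polynomial in time.\<close>

subsection \<open>Legendre-Gauss-Lobatto quadrature\<close>

definition poly_int :: "real poly \<Rightarrow> real" where
  "poly_int p = integral {-1..1} (poly p)"

lemma poly_integrable: "poly (p :: real poly) integrable_on {-1..1}"
  by (intro integrable_continuous_interval continuous_intros)

lemma poly_int_add: "poly_int (p + q) = poly_int p + poly_int q"
  unfolding poly_int_def poly_add[abs_def] by (rule integral_add) (rule poly_integrable)+

lemma poly_int_smult: "poly_int (smult c p) = c * poly_int p"
  unfolding poly_int_def poly_smult[abs_def] by (rule integral_mult_right)

lemma poly_int_0: "poly_int 0 = 0"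
  using poly_int_smult[of 0 0] by simp

lemma poly_int_sum: "poly_int (sum f S) = (\<Sum>i\<in>S. poly_int (f i))"
  by (induction S rule: infinite_finite_induct) (simp_all add: poly_int_0 poly_int_add)

lemma poly_int_pderiv: "poly_int (pderiv p) = poly p 1 - poly p (-1)"
  unfolding poly_int_def
  by (intro integral_unique fundamental_theorem_of_calculus)
     (auto simp: has_real_derivative_iff_has_vector_derivative[symmetric]
           intro!: DERIV_subset[OF poly_DERIV])

lemma poly_int_by_parts:
  "poly_int (p * pderiv q) = poly (p * q) 1 - poly (p * q) (-1) - poly_int (pderiv p * q)"
  using poly_int_pderiv[of "p * q"] by (simp add: pderiv_mult poly_int_add mult.commute)

text \<open>A continuous nonnegative function with integral zero vanishes on the whole interval,
  whereas a nonzero polynomial has finitely many roots.\<close>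

lemma poly_int_pos:
  assumes nonneg: "\<And>x. x \<in> {-1..1} \<Longrightarrow> 0 \<le> poly p x" and nz: "p \<noteq> 0"
  shows "0 < poly_int p"
proof -
  have ge: "0 \<le> poly_int p"
    unfolding poly_int_def using nonneg by (intro integral_nonneg poly_integrable)
  have "poly_int p \<noteq> 0"
  proof
    assume "poly_int p = 0"
    then have "(poly p has_integral 0) (cbox (-1) 1)"
      using poly_integrable[of p] unfolding poly_int_def by (simp add: has_integral_iff)
    moreover have "continuous_on (cbox (-1) 1) (poly p)"
      by (intro continuous_intros)
    ultimately have "poly p x = 0" if "x \<in> {-1..1}" for x
      using that nonneg has_integral_0_cbox_imp_0[of "-1" 1 "poly p" x] by auto
    then have "{-1..1::real} \<subseteq> {x. poly p x = 0}" by auto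
    then have "finite {-1..1::real}"
      using poly_roots_finite[OF nz] finite_subset by blast
    then show False using infinite_Icc[of "-1::real" 1] by simp
  qed
  with ge show ?thesis by simp
qed

text \<open>Rolle's theorem between consecutive points of \<open>A\<close>. The induction adds a new
  maximum \<open>b\<close>; the bounds \<open>Min A\<close> and \<open>Max A\<close> are carried
  along so that the new root, lying beyond \<open>Max A\<close>, differs from those already
  found.\<close>

lemma pderiv_roots_between:
  fixes q :: "real poly"
  assumes "finite A" "A \<noteq> {}" "\<forall>x\<in>A. poly q x = 0"
  shows "\<exists>B. finite B \<and> B \<subseteq> {Min A<..<Max A} \<and> card B + 1 = card A \<and>
             (\<forall>x\<in>B. poly (pderiv q) x = 0)"
  using assms
proof (induction A rule: finite_linorder_max_induct)
  case empty
  then show ?case by simp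
next
  case (insert b A)
  show ?case
  proof (cases "A = {}")
    case True
    then show ?thesis by (intro exI[of _ "{}"]) simp
  next
    case False
    then obtain B where B: "finite B" "B \<subseteq> {Min A<..<Max A}" "card B + 1 = card A"
      "\<forall>x\<in>B. poly (pderiv q) x = 0"
      using insert by auto
    have "Max A \<in> A" "Min A \<in> A" using False insert.hyps by simp_all
    then have mx: "Max A \<in> A" "Max A < b" "Min A \<in> A" "Min A < b" using insert.hyps by auto
    obtain c where c: "Max A < c" "c < b" "poly (pderiv q) c = 0"
      using poly_MVT[of "Max A" b q] mx insert.prems by auto
    have "Min A \<le> Max A" using False insert.hyps by simp
    then have "Min A < c" using c by linarith
    have eq: "Max (insert b A) = b" "Min (insert b A) = Min A"
      using insert.hyps False mx by (simp_all add: max_absorb1 min_absorb2)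
    have "c \<notin> B" using B c by auto
    then show ?thesis using B c eq mx \<open>Min A < c\<close> insert.hyps
      by (intro exI[of _ "insert c B"]) (auto)
  qed
qed

section \<open>Roots of the Legendre polynomials and the number of nodes\<close>

lemma dvd_pderiv_power:
  fixes p q :: "real poly"
  assumes "p ^ Suc m dvd q"
  shows "p ^ m dvd pderiv q"
proof -
  obtain r where "q = p ^ Suc m * r" using assms by (auto elim: dvdE)
  then have "pderiv q = p ^ m * (p * pderiv r + smult (of_nat (Suc m)) (pderiv p * r))"
    by (simp only: pderiv_mult pderiv_power_Suc) (simp add: algebra_simps)
  then show ?thesis by simp
qed

lemma dvd_higher_pderiv_power:
  fixes p q :: "real poly"
  assumes "p ^ m dvd q" "k \<le> m"
  shows "p ^ (m - k) dvd (pderiv ^^ k) q"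
  using assms(2)
proof (induction k)
  case 0
  then show ?case using assms(1) by simp
next
  case (Suc k)
  then show ?case by (auto simp: Suc_diff_Suc intro!: dvd_pderiv_power)
qed

text \<open>The intermediate derivatives in Rodrigues' formula: counting roots and proving
  orthogonality both go by induction on \<open>k\<close>, reaching a multiple of
  \<open>Legendre N\<close> at \<open>k = N\<close>.\<close>

definition rodrigues :: "nat \<Rightarrow> nat \<Rightarrow> real poly" where
  "rodrigues N k = (pderiv ^^ k) ([:-1, 0, 1:] ^ N)"

lemma rodrigues_Suc: "rodrigues N (Suc k) = pderiv (rodrigues N k)"
  by (simp add: rodrigues_def)

lemma Legendre_rodrigues: "Legendre N = smult (1 / (2 ^ N * fact N)) (rodrigues N N)"
  by (simp add: Legendre_def rodrigues_def)

text \<open>Each differentiation costs at most one factor x^2 - 1, so one is left after fewer than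
  \<open>N\<close> of them.\<close>

lemma rodrigues_end:
  assumes "k < N" "x = 1 \<or> x = -1"
  shows "poly (rodrigues N k) x = 0"
proof -
  have "[:-1, 0, 1:] dvd rodrigues N k"
    using dvd_higher_pderiv_power[of "[:-1, 0, 1:]" N "[:-1, 0, 1:] ^ N" k]
      dvd_power[of "N - k" "[:-1, 0, 1:] :: real poly"] assms(1)
    unfolding rodrigues_def by (meson dvd_refl dvd_trans less_imp_le zero_less_diff)
  then show ?thesis using assms(2) by (auto elim!: dvdE)
qed

text \<open>Each differentiation gains one root: Rolle is applied to the \<open>k\<close> interior
  roots together with the two end points, which are roots as long as \<open>k < N\<close>.\<close>

lemma rodrigues_roots:
  "k \<le> N \<Longrightarrow> \<exists>B. finite B \<and> B \<subseteq> {-1<..<1} \<and> card B = k \<and> (\<forall>x\<in>B. poly (rodrigues N k) x = 0)"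
proof (induction k)
  case 0
  then show ?case by (intro exI[of _ "{}"]) simp
next
  case (Suc k)
  then obtain B where B: "finite B" "B \<subseteq> {-1<..<1}" "card B = k"
    "\<forall>x\<in>B. poly (rodrigues N k) x = 0" by auto
  let ?A = "insert (-1) (insert 1 B)"
  have "\<forall>x\<in>?A. poly (rodrigues N k) x = 0"
    using B rodrigues_end[of k N] Suc.prems by auto
  moreover have "finite ?A" using B by simp
  ultimately obtain C where C: "finite C" "C \<subseteq> {Min ?A<..<Max ?A}" "card C + 1 = card ?A"
    "\<forall>x\<in>C. poly (pderiv (rodrigues N k)) x = 0"
    using pderiv_roots_between[of ?A "rodrigues N k"] by blast
  have "Min ?A = -1" "Max ?A = 1"
    using B by (intro Min_eqI Max_eqI; force)+
  moreover have "card ?A = k + 2"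
  proof -
    have "1 \<notin> B" "-1 \<notin> insert 1 B" using B by auto
    then show ?thesis using B by simp
  qed
  ultimately show ?case using C by (auto simp: rodrigues_Suc)
qed

text \<open>Rolle turns the \<open>N\<close> roots of the Legendre polynomial in (-1, 1) into N - 1
  roots of its derivative; with the two end points they attain the bound given by the
  degree.\<close>

lemma card_LGL_nodes:
  assumes N: "1 \<le> N"
  shows "card (LGL_nodes N) = N + 1"
proof -
  obtain A where A: "finite A" "A \<subseteq> {-1<..<1}" "card A = N" "\<forall>x\<in>A. poly (rodrigues N N) x = 0"
    using rodrigues_roots[of N N] by auto
  then have ne: "A \<noteq> {}" using N by auto
  obtain B where B: "finite B" "B \<subseteq> {Min A<..<Max A}" "card B + 1 = N"
    "\<forall>x\<in>B. poly (pderiv (rodrigues N N)) x = 0"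
    using pderiv_roots_between[OF A(1) ne A(4)] A(3) by auto
  have "Min A \<in> A" "Max A \<in> A" using A ne by auto
  then have sub: "B \<subseteq> {-1<..<1}" using A B by force
  have "insert (-1) (insert 1 B) \<subseteq> LGL_nodes N"
    using B by (auto simp: LGL_nodes_def Legendre_rodrigues pderiv_smult)
  moreover have "card (insert (-1) (insert 1 B)) = N + 1"
  proof -
    have "1 \<notin> B" "-1 \<notin> insert 1 B" using sub by auto
    then show ?thesis using B by simp
  qed
  ultimately have "N + 1 \<le> card (LGL_nodes N)"
    using card_mono[OF finite_LGL_nodes[OF N]] by metis
  with card_LGL_nodes_le[OF N] show ?thesis by simp
qed

section \<open>Interpolation at the nodes and exactness of the quadrature\<close>

lemma poly_eq_on_nodes:
  assumes N: "1 \<le> N" and deg: "degree p \<le> N" "degree q \<le> N"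
    and eq: "\<And>\<xi>. \<xi> \<in> LGL_nodes N \<Longrightarrow> poly p \<xi> = poly q \<xi>"
  shows "p = q"
proof (rule ccontr)
  assume "p \<noteq> q"
  then have nz: "p - q \<noteq> 0" by simp
  have "LGL_nodes N \<subseteq> {x. poly (p - q) x = 0}" using eq by auto
  then have "N + 1 \<le> card {x. poly (p - q) x = 0}"
    using card_mono[OF poly_roots_finite[OF nz]] card_LGL_nodes[OF N] by metis
  also have "\<dots> \<le> degree (p - q)" by (rule card_poly_roots_bound[OF nz])
  also have "\<dots> \<le> N" using degree_diff_le deg by blast
  finally show False by simp
qed

lemma LGL_lagrange:
  assumes N: "1 \<le> N" and deg: "degree p \<le> N"
  shows "p = (\<Sum>\<xi>\<in>LGL_nodes N. smult (poly p \<xi>) (LGL_basis N \<xi>))"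
proof (rule poly_eq_on_nodes[OF N deg])
  show "degree (\<Sum>\<xi>\<in>LGL_nodes N. smult (poly p \<xi>) (LGL_basis N \<xi>)) \<le> N"
    using LGL_basis_in[OF N] unfolding polys_upto_def
    by (intro degree_sum_le finite_LGL_nodes[OF N]) (auto intro: order_trans[OF degree_smult_le])
  fix \<eta> assume "\<eta> \<in> LGL_nodes N"
  then show "poly p \<eta> = poly (\<Sum>\<xi>\<in>LGL_nodes N. smult (poly p \<xi>) (LGL_basis N \<xi>)) \<eta>"
    by (simp add: poly_sum poly_LGL_basis[OF N] finite_LGL_nodes[OF N] if_distrib cong: if_cong)
qed

text \<open>Integration by parts moves one derivative at a time onto \<open>p\<close>, without end
  terms by \<open>rodrigues_end\<close>; \<open>k\<close> differentiations annihilate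
  \<open>p\<close>.\<close>

lemma rodrigues_orthogonal:
  "k \<le> N \<Longrightarrow> degree p < k \<Longrightarrow> poly_int (p * rodrigues N k) = 0"
proof (induction k arbitrary: p)
  case 0
  then show ?case by simp
next
  case (Suc k)
  have "poly_int (pderiv p * rodrigues N k) = 0"
  \<comment> \<open>The derivative of a constant still has degree 0, which is not below
    \<open>k\<close> when \<open>k = 0\<close>; the induction hypothesis covers only nonconstant
    \<open>p\<close>.\<close>
  proof (cases "degree p = 0")
    case True
    then show ?thesis by (simp add: pderiv_eq_0_iff[THEN iffD2] poly_int_0)
  next
    case False
    then show ?thesis using Suc by (intro Suc.IH) (auto simp: degree_pderiv)
  qed
  then show ?case
    using Suc.prems rodrigues_end[of k N] unfolding rodrigues_Suc
    by (subst poly_int_by_parts) simp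
qed

text \<open>The factor 1 - x^2 removes the end terms of an integration by parts; what then
  multiplies \<open>Legendre N\<close> has degree below \<open>N\<close>.\<close>

lemma node_poly_orthogonal:
  assumes "degree q + 2 \<le> N"
  shows "poly_int (q * ([:1, 0, -1:] * pderiv (Legendre N))) = 0"
proof -
  let ?p = "q * [:1, 0, -1:]"
  have "degree ?p \<le> degree q + degree [:1, 0, -1::real:]" by (rule degree_mult_le)
  then have "degree (pderiv ?p) < N"
    using assms by (auto simp: degree_pderiv simp del: mult_pCons_right)
  then have "poly_int (pderiv ?p * Legendre N) = 0"
    using rodrigues_orthogonal[of N N "pderiv ?p"]
    by (simp add: Legendre_rodrigues poly_int_smult del: mult_pCons_right)
  then have "poly_int (?p * pderiv (Legendre N)) = 0"
    by (subst poly_int_by_parts) (simp del: mult_pCons_right)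
  then show ?thesis by (simp only: mult.assoc)
qed

text \<open>Division by the node polynomial \<open>M\<close>: the multiple of \<open>M\<close>
  vanishes at the nodes and integrates to zero, since a nonzero quotient has degree at most N - 2.
  The remainder has degree at most \<open>N\<close> and equals its interpolant, where the weights
  are right by definition.\<close>

lemma LGL_quadrature:
  assumes N: "1 \<le> N" and deg: "degree p \<le> 2 * N - 1"
  shows "poly_int p = (\<Sum>\<xi>\<in>LGL_nodes N. LGL_weight N \<xi> * poly p \<xi>)"
proof -
  define M where "M = [:1, 0, -1:] * pderiv (Legendre N)"
  have M: "M \<noteq> 0" "degree M = N + 1" using LGL_node_poly[OF N] by (auto simp: M_def)
  define q r where "q = p div M" and "r = p mod M"
  have p: "p = q * M + r" by (simp add: q_def r_def)
  have r: "degree r \<le> N"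
    using degree_mod_less[OF M(1), of p] M(2) by (auto simp: r_def)
  have "poly_int (q * M) = 0"
  proof (cases "q = 0")
    case True
    then show ?thesis by (simp add: poly_int_0)
  next
    case False
    then have dqM: "degree (q * M) = degree q + (N + 1)"
      using M by (simp add: degree_mult_eq)
    have "degree (q * M) \<le> 2 * N - 1"
    proof -
      have "q * M = p - r" using p by simp
      then show ?thesis using degree_diff_le[of p "2 * N - 1" r] deg r N by simp
    qed
    then have "degree q + 2 \<le> N" using dqM N by linarith
    then show ?thesis
      unfolding M_def by (rule node_poly_orthogonal)
  qed
  then have "poly_int p = poly_int r" by (simp add: p poly_int_add)
  also have "\<dots> = (\<Sum>\<xi>\<in>LGL_nodes N. LGL_weight N \<xi> * poly r \<xi>)"
    by (subst LGL_lagrange[OF N r])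
       (simp add: poly_int_sum poly_int_smult poly_int_def[of "LGL_basis _ _"] LGL_weight_def mult.commute)
  also have "\<dots> = (\<Sum>\<xi>\<in>LGL_nodes N. LGL_weight N \<xi> * poly p \<xi>)"
    by (intro sum.cong) (auto simp: p LGL_nodes_def M_def)
  finally show ?thesis .
qed

text \<open>This lets nodal values represent functionals and makes the factors in front of q''(-1)
  and q''(1) nonzero.\<close>

lemma LGL_weight_nonzero:
  assumes N: "1 \<le> N" and \<xi>: "\<xi> \<in> LGL_nodes N"
  shows "LGL_weight N \<xi> \<noteq> 0"
proof -
  let ?B = "LGL_basis N \<xi>"
  have deg: "degree ?B \<le> N" using LGL_basis_in[OF N \<xi>] by (simp add: polys_upto_def)
  have nz: "?B \<noteq> 0" using poly_LGL_basis[OF N \<xi>, of \<xi>] by auto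
  \<comment> \<open>The square of the basis polynomial has degree 2 * N, one too many for the quadrature;
    dividing by its factor at an end point repairs this.\<close>
  obtain e s :: real where es: "e \<in> LGL_nodes N" "e \<noteq> \<xi>" "\<And>x. x \<in> {-1..1} \<Longrightarrow> 0 \<le> s * (x - e)"
    "s \<noteq> 0"
  proof (cases "\<xi> = 1")
    case True
    show ?thesis by (rule that[of "-1" 1]) (auto simp: LGL_end_nodes True)
  next
    case False
    show ?thesis by (rule that[of 1 "-1"]) (use False LGL_end_nodes in auto)
  qed
  have "poly ?B e = 0" using poly_LGL_basis[OF N es(1), of \<xi>] es(2) by simp
  then obtain C where C: "?B = [:-e, 1:] * C" by (auto simp: poly_eq_0_iff_dvd elim: dvdE)
  define q where "q = smult s (?B * C)"
  have Cnz: "C \<noteq> 0" using C nz by auto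
  have dC: "degree ?B = degree C + 1"
    unfolding C using Cnz by (subst degree_mult_eq) auto
  have "degree q \<le> 2 * N - 1"
  proof -
    have "degree q = degree ?B + degree C"
      using es nz Cnz by (simp add: q_def degree_mult_eq)
    then show ?thesis using dC deg by simp
  qed
  then have "poly_int q = (\<Sum>\<eta>\<in>LGL_nodes N. LGL_weight N \<eta> * poly q \<eta>)"
    by (rule LGL_quadrature[OF N])
  also have "\<dots> = (\<Sum>\<eta>\<in>LGL_nodes N. if \<eta> = \<xi> then LGL_weight N \<xi> * poly q \<xi> else 0)"
    by (intro sum.cong) (auto simp: q_def poly_LGL_basis[OF N])
  also have "\<dots> = LGL_weight N \<xi> * poly q \<xi>"
    using \<xi> finite_LGL_nodes[OF N] by simp
  also have "poly q \<xi> = s * poly C \<xi>"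
    by (simp add: q_def poly_LGL_basis[OF N \<xi>])
  finally have eq: "poly_int q = LGL_weight N \<xi> * (s * poly C \<xi>)" .
  have qx: "poly q x = s * (x - e) * (poly C x)\<^sup>2" for x
    by (simp add: q_def C power2_eq_square algebra_simps)
  have "0 < poly_int q"
  proof (rule poly_int_pos)
    show "q \<noteq> 0" using nz Cnz es by (simp add: q_def)
    show "0 \<le> poly q x" if "x \<in> {-1..1}" for x
      unfolding qx using es(3)[OF that] by simp
  qed
  then show ?thesis unfolding eq by auto
qed

subsection \<open>Steering with a single input\<close>

interpretation poly_vs: vector_space "smult :: real \<Rightarrow> real poly \<Rightarrow> real poly"
  by standard (simp_all add: smult_add_right smult_add_left)

interpretation poly_functional: vector_space_pair
  "smult :: real \<Rightarrow> real poly \<Rightarrow> real poly" "(*) :: real \<Rightarrow> real \<Rightarrow> real"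
  by standard (simp_all add: algebra_simps)

definition smult_linear :: "(real poly \<Rightarrow> real poly) \<Rightarrow> bool" where
  "smult_linear A \<longleftrightarrow> (\<forall>p q. A (p + q) = A p + A q) \<and> (\<forall>c p. A (smult c p) = smult c (A p))"

lemma smult_linear_0: "smult_linear A \<Longrightarrow> A 0 = 0"
  unfolding smult_linear_def using smult_0_left by metis

lemma smult_linear_sum:
  assumes "smult_linear A"
  shows "A (\<Sum>i\<in>I. smult (c i) (f i)) = (\<Sum>i\<in>I. smult (c i) (A (f i)))"
  using assms smult_linear_0[OF assms]
  by (induction I rule: infinite_finite_induct) (simp_all add: smult_linear_def)

text \<open>The coefficients are attached to indices and not to vectors, so the \<open>f k\<close>
  may repeat.\<close>

lemma span_image_lessThan:
  assumes "x \<in> poly_vs.span (f ` {..<n::nat})"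
  shows "\<exists>c. x = (\<Sum>k<n. smult (c k) (f k))"
  using assms
proof (induction n arbitrary: x)
  case 0
  then show ?case by simp
next
  case (Suc n)
  then obtain a where "x - smult a (f n) \<in> poly_vs.span (f ` {..<n})"
    by (auto simp: lessThan_Suc poly_vs.span_insert)
  then obtain c where c: "x - smult a (f n) = (\<Sum>k<n. smult (c k) (f k))"
    using Suc.IH by blast
  have "(\<Sum>k<n. smult ((c(n := a)) k) (f k)) = (\<Sum>k<n. smult (c k) (f k))"
    by (intro sum.cong) auto
  then have "x = (\<Sum>k<Suc n. smult ((c(n := a)) k) (f k))"
    using c by (simp add: diff_eq_eq)
  then show ?case by (rule exI[where x="c(n := a)"])
qed

text \<open>Otherwise the first \<open>Suc (card S)\<close> vectors would be distinct and
  independent inside the span of \<open>S\<close>.\<close>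

lemma krylov_relation:
  fixes f :: "nat \<Rightarrow> real poly"
  assumes "finite S" and "\<And>k. f k \<in> poly_vs.span S"
  shows "\<exists>n. f n \<in> poly_vs.span (f ` {..<n})"
proof (rule ccontr)
  assume neg: "\<nexists>n. f n \<in> poly_vs.span (f ` {..<n})"
  have "poly_vs.independent (f ` {..<n}) \<and> card (f ` {..<n}) = n" for n
  proof (induction n)
    case 0
    then show ?case by (simp add: poly_vs.independent_empty)
  next
    case (Suc n)
    have notin: "f n \<notin> poly_vs.span (f ` {..<n})" using neg by simp
    then have "f n \<notin> f ` {..<n}" by (metis poly_vs.span_base)
    then have "card (insert (f n) (f ` {..<n})) = Suc n" using Suc by simp
    moreover have "poly_vs.independent (insert (f n) (f ` {..<n}))"
      using notin Suc by (intro poly_vs.independent_insertI) simp_all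
    ultimately show ?case unfolding lessThan_Suc image_insert by simp
  qed
  then have ind: "poly_vs.independent (f ` {..<Suc (card S)})" "card (f ` {..<Suc (card S)}) = Suc (card S)"
    by blast+
  have "f ` {..<Suc (card S)} \<subseteq> poly_vs.span S" using assms(2) by blast
  from poly_vs.independent_span_bound[OF assms(1) ind(1) this] show False
    unfolding ind(2) by simp
qed

text \<open>The \<open>v i\<close> are the coefficients, in decreasing powers of \<open>s\<close>, of the polynomial
  \<open>(\<chi>(s) - \<chi>(A)) / (s - A)\<close> applied to \<open>b\<close>, where \<open>\<chi>\<close> annihilates \<open>b\<close>.\<close>

lemma krylov_horner:
  assumes A: "smult_linear A" and "finite S" and "\<And>k. (A ^^ k) b \<in> poly_vs.span S"
  shows "\<exists>v d n. v 0 = b \<and> (\<forall>i. v (Suc i) = A (v i) + smult (d i) b) \<and> v (n::nat) = 0"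
proof -
  obtain n where "(A ^^ n) b \<in> poly_vs.span ((\<lambda>k. (A ^^ k) b) ` {..<n})"
    using krylov_relation[of S "\<lambda>k. (A ^^ k) b"] assms by blast
  then obtain c where c: "(A ^^ n) b = (\<Sum>k<n. smult (c k) ((A ^^ k) b))"
    using span_image_lessThan by blast
  \<comment> \<open>Here \<open>\<chi>\<close> is s^n minus the sum of the c_k s^k, and
    \<open>d i\<close> is its coefficient at s^(n - 1 - i).\<close>
  define d where "d i = - c (n - Suc i)" for i
  define v where "v = rec_nat b (\<lambda>i w. A w + smult (d i) b)"
  have v: "v 0 = b" "v (Suc i) = A (v i) + smult (d i) b" for i
    by (simp_all add: v_def)
  have "v i = (A ^^ i) b + (\<Sum>m<i. smult (d m) ((A ^^ (i - Suc m)) b))" for i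
  proof (induction i)
    case 0
    then show ?case by (simp add: v)
  next
    case (Suc i)
    have "A (\<Sum>m<i. smult (d m) ((A ^^ (i - Suc m)) b))
        = (\<Sum>m<i. smult (d m) ((A ^^ (Suc i - Suc m)) b))"
      unfolding smult_linear_sum[OF A]
    proof (intro sum.cong refl)
      fix m assume "m \<in> {..<i}"
      then have "Suc i - Suc m = Suc (i - Suc m)" by auto
      then show "smult (d m) (A ((A ^^ (i - Suc m)) b)) = smult (d m) ((A ^^ (Suc i - Suc m)) b)"
        by simp
    qed
    then show ?case using Suc A by (simp add: v smult_linear_def)
  qed
  then have "v n = (A ^^ n) b + (\<Sum>m<n. smult (d m) ((A ^^ (n - Suc m)) b))" .
  also have "(\<Sum>m<n. smult (d m) ((A ^^ (n - Suc m)) b)) = - (\<Sum>m<n. smult (c (n - Suc m)) ((A ^^ (n - Suc m)) b))"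
    by (simp add: d_def sum_negf)
  also have "(\<Sum>m<n. smult (c (n - Suc m)) ((A ^^ (n - Suc m)) b)) = (A ^^ n) b"
    unfolding c by (rule sum.nat_diff_reindex)
  finally have "v n = 0" by simp
  then show ?thesis using v by (intro exI[of _ v] exI[of _ d] exI[of _ n]) blast
qed

text \<open>The span of the Horner vectors contains \<open>b\<close> and is invariant:
  \<open>A (v i)\<close> is \<open>v (Suc i)\<close> minus a multiple of \<open>b\<close>, and
  \<open>v n = 0\<close> closes the chain.\<close>

lemma krylov_horner_span:
  assumes A: "smult_linear A" and v: "v 0 = b" "\<And>i. v (Suc i) = A (v i) + smult (d i) b" "v n = 0"
  shows "(A ^^ k) b \<in> poly_vs.span (v ` {..<n})"
proof -
  let ?U = "poly_vs.span (v ` {..<n})"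
  have vU: "v i \<in> ?U" if "i \<le> n" for i
    using that v(3) by (cases "i = n") (auto intro: poly_vs.span_base poly_vs.span_zero)
  have b: "b \<in> ?U" using vU[of 0] v by simp
  have "?U \<subseteq> {x. A x \<in> ?U}"
  proof (rule poly_vs.span_minimal)
    show "v ` {..<n} \<subseteq> {x. A x \<in> ?U}"
    proof clarify
      fix i assume "i < n"
      have "A (v i) = v (Suc i) - smult (d i) b" by (simp add: v)
      then show "A (v i) \<in> ?U"
        using vU[of "Suc i"] b \<open>i < n\<close> by (simp add: poly_vs.span_diff poly_vs.span_scale)
    qed
    show "poly_vs.subspace {x. A x \<in> ?U}"
      using A smult_linear_0[OF A]
      by (auto simp: poly_vs.subspace_def smult_linear_def
          intro: poly_vs.span_zero poly_vs.span_add poly_vs.span_scale)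
  qed
  then show ?thesis by (induction k) (use b in auto)
qed

text \<open>Adding a suitable multiple of x^m q corrects the coefficient at x^m and leaves the lower
  ones alone.\<close>

lemma coeff_prescribed_multiple:
  fixes q :: "real poly"
  assumes "coeff q 0 \<noteq> 0"
  shows "\<exists>p. q dvd p \<and> (\<forall>k<m. coeff p k = a k)"
proof (induction m)
  case 0
  then show ?case by auto
next
  case (Suc m)
  then obtain p where p: "q dvd p" "\<forall>k<m. coeff p k = a k" by blast
  let ?r = "p + monom ((a m - coeff p m) / coeff q 0) m * q"
  have "q dvd ?r" using p by simp
  moreover have "\<forall>k<Suc m. coeff ?r k = a k"
    using p assms by (auto simp: less_Suc_eq coeff_monom_mult)
  ultimately show ?case by blast
qed

text \<open>A multiple of (t - T)^m is flat at \<open>T\<close>, and \<open>T \<noteq> 0\<close>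
  allows its Taylor coefficients at 0 to be prescribed.\<close>

lemma two_point_hermite:
  fixes T :: real
  assumes "T \<noteq> 0"
  obtains \<eta> where "\<And>k. k < m \<Longrightarrow> poly ((pderiv ^^ k) \<eta>) 0 = a k"
    "\<And>k. k < m \<Longrightarrow> poly ((pderiv ^^ k) \<eta>) T = 0"
proof -
  have "coeff ([:-T, 1:] ^ m) 0 \<noteq> 0"
    using assms by (simp flip: poly_0_coeff_0)
  then obtain \<eta> where \<eta>: "[:-T, 1:] ^ m dvd \<eta>" "\<And>k. k < m \<Longrightarrow> coeff \<eta> k = a k / fact k"
    using coeff_prescribed_multiple[of _ m "\<lambda>k. a k / fact k"] by blast
  show ?thesis
  proof
    fix k assume k: "k < m"
    show "poly ((pderiv ^^ k) \<eta>) 0 = a k"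
      using \<eta>(2)[OF k] by (simp add: poly_0_coeff_0 coeff_higher_pderiv pochhammer_fact[symmetric])
    have "[:-T, 1:] dvd (pderiv ^^ k) \<eta>"
      using dvd_higher_pderiv_power[OF \<eta>(1), of k] k dvd_power[of "m - k" "[:-T, 1:]"]
      by (meson dvd_trans less_imp_le zero_less_diff)
    then show "poly ((pderiv ^^ k) \<eta>) T = 0" by (simp add: poly_eq_0_iff_dvd)
  qed
qed

lemma DERIV_poly_curve:
  fixes e v :: "nat \<Rightarrow> real poly"
  shows "((\<lambda>s. poly (\<Sum>i<n. smult (poly (e i) s) (v i)) x) has_real_derivative
    poly (\<Sum>i<n. smult (poly (pderiv (e i)) t) (v i)) x) (at t)"
  unfolding poly_sum poly_smult by (intro DERIV_sum DERIV_cmult_right poly_DERIV)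

text \<open>Flatness: with the Horner vectors \<open>v i\<close> the trajectory is
  \<open>z = (\<Sum>i<n. \<eta>\<^bsup>(2 (n - 1 - i))\<^esup> v i)\<close> for an arbitrary scalar function \<open>\<eta>\<close>.\<close>

lemma single_input_steering:
  fixes A :: "real poly \<Rightarrow> real poly" and T :: real
  assumes A: "smult_linear A" and fin: "finite S" and S: "\<And>k. (A ^^ k) b \<in> poly_vs.span S"
    and T: "T \<noteq> 0"
    and y: "y0 \<in> poly_vs.span (range (\<lambda>k. (A ^^ k) b))" "y1 \<in> poly_vs.span (range (\<lambda>k. (A ^^ k) b))"
  obtains z z' and g :: "real poly" where
    "\<And>t x. ((\<lambda>s. poly (z s) x) has_real_derivative poly (z' t) x) (at t)"
    "\<And>t x. ((\<lambda>s. poly (z' s) x) has_real_derivative poly (A (z t) + smult (poly g t) b) x) (at t)"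
    "z 0 = y0" "z' 0 = y1" "z T = 0" "z' T = 0"
    "\<And>t. z t \<in> poly_vs.span (range (\<lambda>k. (A ^^ k) b))"
proof -
  let ?K = "poly_vs.span (range (\<lambda>k. (A ^^ k) b))"
  obtain v d n where "v 0 = b \<and> (\<forall>i. v (Suc i) = A (v i) + smult (d i) b) \<and> v (n::nat) = 0"
    using krylov_horner[OF A fin S] by (elim exE)
  then have v: "v 0 = b" "\<And>i. v (Suc i) = A (v i) + smult (d i) b" "v n = 0" by simp_all
  have "?K \<subseteq> poly_vs.span (v ` {..<n})"
    by (intro poly_vs.span_minimal image_subsetI poly_vs.subspace_span krylov_horner_span[where d=d])
       (use A v in auto)
  with y have "y0 \<in> poly_vs.span (v ` {..<n})" "y1 \<in> poly_vs.span (v ` {..<n})" by blast+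
  from this[THEN span_image_lessThan] obtain \<alpha> \<beta>
    where \<alpha>: "y0 = (\<Sum>i<n. smult (\<alpha> i) (v i))" and \<beta>: "y1 = (\<Sum>i<n. smult (\<beta> i) (v i))"
    by blast
  \<comment> \<open>Invariance puts all Horner vectors, and hence the whole trajectory, into the
    Krylov space.\<close>
  have "?K \<subseteq> {x. A x \<in> ?K}"
  proof (rule poly_vs.span_minimal)
    have "A ((A ^^ k) b) \<in> ?K" for k
      using poly_vs.span_base[OF rangeI[of "\<lambda>k. (A ^^ k) b" "Suc k"]] by simp
    then show "range (\<lambda>k. (A ^^ k) b) \<subseteq> {x. A x \<in> ?K}" by blast
    show "poly_vs.subspace {x. A x \<in> ?K}"
      using A smult_linear_0[OF A]
      by (auto simp: poly_vs.subspace_def smult_linear_def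
          intro: poly_vs.span_zero poly_vs.span_add poly_vs.span_scale)
  qed
  moreover have bK: "b \<in> ?K" using poly_vs.span_base[OF rangeI[of "\<lambda>k. (A ^^ k) b" 0]] by simp
  ultimately have vK: "v i \<in> ?K" for i
    by (induction i) (auto simp: v intro!: poly_vs.span_add poly_vs.span_scale)
  \<comment> \<open>The coefficient of \<open>v i\<close> in z(0) is the derivative of
    \<open>\<eta>\<close> of order 2 (n - 1 - i), in z'(0) the next odd one. So even orders carry
    the coordinates of \<open>y0\<close> and odd orders those of \<open>y1\<close>, both in reversed
    order.\<close>
  define a where "a k = (if even k then \<alpha> (n - Suc (k div 2)) else \<beta> (n - Suc (k div 2)))" for k
  obtain \<eta> where \<eta>0: "\<And>k. k < 2 * n \<Longrightarrow> poly ((pderiv ^^ k) \<eta>) 0 = a k"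
    and \<eta>T: "\<And>k. k < 2 * n \<Longrightarrow> poly ((pderiv ^^ k) \<eta>) T = 0"
    by (rule two_point_hermite[OF T, of "2 * n" a]) blast
  define e where "e m = (pderiv ^^ (2 * m)) \<eta>" for m
  have e2: "pderiv (pderiv (e m)) = e (Suc m)" for m by (simp add: e_def)
  define z where "z t = (\<Sum>i<n. smult (poly (e (n - Suc i)) t) (v i))" for t
  define z' where "z' t = (\<Sum>i<n. smult (poly (pderiv (e (n - Suc i))) t) (v i))" for t
  define g where "g = e n + (\<Sum>i<n. smult (d i) (e (n - Suc i)))"
  \<comment> \<open>The left side is z''. A term with \<open>i = n\<close> can be added because
    \<open>v n = 0\<close>; after \<open>i = 0\<close> is split off, the recursion for
    \<open>v (Suc i)\<close> produces \<open>A (z t)\<close>, and all multiples of \<open>b\<close>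
    are collected in \<open>g\<close>.\<close>
  have rhs: "(\<Sum>i<n. smult (poly (e (n - i)) t) (v i)) = A (z t) + smult (poly g t) b" for t
  proof -
    have "(\<Sum>i<n. smult (poly (e (n - i)) t) (v i)) = (\<Sum>i<Suc n. smult (poly (e (n - i)) t) (v i))"
      by (simp add: v)
    also have "\<dots> = smult (poly (e n) t) b + (\<Sum>i<n. smult (poly (e (n - Suc i)) t) (v (Suc i)))"
      by (subst sum.lessThan_Suc_shift) (simp add: v(1))
    also have "(\<Sum>i<n. smult (poly (e (n - Suc i)) t) (v (Suc i))) =
        A (z t) + (\<Sum>i<n. smult (poly (e (n - Suc i)) t * d i) b)"
      by (simp add: z_def smult_linear_sum[OF A] v(2) smult_add_right sum.distrib)
    finally show ?thesis
      by (simp add: g_def poly_sum smult_add_left mult.commute flip: smult_sum)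
  qed
  show ?thesis
  proof (rule that[of z z' g])
    show "((\<lambda>s. poly (z s) x) has_real_derivative poly (z' t) x) (at t)" for t x
      unfolding z_def z'_def by (rule DERIV_poly_curve)
    show "((\<lambda>s. poly (z' s) x) has_real_derivative poly (A (z t) + smult (poly g t) b) x) (at t)" for t x
    proof -
      have "(\<Sum>i<n. smult (poly (pderiv (pderiv (e (n - Suc i)))) t) (v i)) = A (z t) + smult (poly g t) b"
        unfolding rhs[symmetric] by (intro sum.cong) (simp_all add: e2 Suc_diff_Suc)
      from this[symmetric] show ?thesis
        unfolding z'_def by (simp only:) (rule DERIV_poly_curve)
    qed
    show "z t \<in> ?K" for t
      unfolding z_def by (intro poly_vs.span_sum poly_vs.span_scale vK)
    have idx: "2 * (n - Suc i) < 2 * n" "Suc (2 * (n - Suc i)) < 2 * n" "n - Suc (n - Suc i) = i"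
      if "i < n" for i using that by auto
    have dd: "pderiv (e m) = (pderiv ^^ Suc (2 * m)) \<eta>" for m by (simp add: e_def)
    show "z 0 = y0"
      unfolding z_def \<alpha> e_def by (intro sum.cong) (auto simp: \<eta>0 idx a_def)
    show "z' 0 = y1"
      unfolding z'_def \<beta> dd using idx by (intro sum.cong) (auto simp: \<eta>0 a_def simp del: funpow.simps)
    show "z T = 0"
      unfolding z_def e_def by (intro sum.neutral) (auto simp: \<eta>T idx)
    show "z' T = 0"
      unfolding z'_def dd using idx by (intro sum.neutral) (auto simp: \<eta>T simp del: funpow.simps)
  qed
qed

subsection \<open>Krylov spaces of the boundary controls\<close>

text \<open>Since \<open>x\<close> is independent of a basis of the span of \<open>K\<close>, a
  linear functional can be 1 at \<open>x\<close> and 0 on that basis.\<close>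

lemma separating_functional:
  assumes notin: "x \<notin> poly_vs.span K"
  shows "\<exists>g. (\<forall>p q. g (p + q) = g p + g q) \<and> (\<forall>c p. g (smult c p) = c * g p) \<and>
    (\<forall>p\<in>K. g p = 0) \<and> g x = (1::real)"
proof -
  obtain B where B: "B \<subseteq> K" "poly_vs.independent B" "K \<subseteq> poly_vs.span B"
    by (rule poly_vs.maximal_independent_subset)
  have xB: "x \<notin> poly_vs.span B" using notin poly_vs.span_mono[OF B(1)] by auto
  then have "x \<notin> B" using poly_vs.span_base[of x B] by auto
  have ind: "poly_vs.independent (insert x B)"
    by (rule poly_vs.independent_insertI[OF xB B(2)])
  obtain g where g: "Vector_Spaces.linear smult (*) g \<and>
      (\<forall>y\<in>insert x B. g y = (if y = x then 1 else 0 :: real))"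
    using poly_functional.linear_independent_extend[OF ind, of "\<lambda>y. if y = x then 1 else 0"] by (elim exE)
  then have lin: "Vector_Spaces.linear smult (*) g" by simp
  have "g p = 0" if "p \<in> K" for p
  proof (rule poly_functional.linear_eq_0_on_span[OF lin])
    show "p \<in> poly_vs.span B" using that B(3) by auto
    show "g y = 0" if "y \<in> B" for y using that g \<open>x \<notin> B\<close> by auto
  qed
  then show ?thesis
    using g lin unfolding linear_iff_module_hom module_hom_iff by (intro exI[of _ g]) simp
qed

section \<open>The discrete Laplacian, its symmetry, and the input functionals\<close>

lemma LGL_ends_notin_interior: "1 \<notin> LGL_interior N" "-1 \<notin> LGL_interior N"
  by (simp_all add: LGL_interior_def)

lemma LGL_nodes_cases: "\<xi> \<in> LGL_nodes N \<longleftrightarrow> \<xi> = -1 \<or> \<xi> = 1 \<or> \<xi> \<in> LGL_interior N"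
  using LGL_end_nodes[of N] by (auto simp: LGL_interior_def)

text \<open>End values are replaced by zero, which gives a state in \<open>polys_upto_Di N\<close>
  for a right-hand side known at the interior nodes.\<close>

definition nodal_interp :: "nat \<Rightarrow> real poly \<Rightarrow> real poly" where
  "nodal_interp N p = (\<Sum>\<xi>\<in>LGL_interior N. smult (poly p \<xi>) (LGL_basis N \<xi>))"

definition disc_lap :: "nat \<Rightarrow> real poly \<Rightarrow> real poly" where
  "disc_lap N p = nodal_interp N (pderiv (pderiv p))"

text \<open>The end nodes are included so that the quadrature applies; they contribute nothing once
  one argument vanishes there.\<close>

definition nodal_ip :: "nat \<Rightarrow> real poly \<Rightarrow> real poly \<Rightarrow> real" where
  "nodal_ip N p q = (\<Sum>\<xi>\<in>LGL_nodes N. LGL_weight N \<xi> * poly p \<xi> * poly q \<xi>)"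

text \<open>The input enters through its interior nodal values, hence the interpolation.\<close>

definition krylov :: "nat \<Rightarrow> real poly \<Rightarrow> real poly set" where
  "krylov N b = range (\<lambda>k. (disc_lap N ^^ k) (nodal_interp N b))"

lemma Di_degree: "p \<in> polys_upto_Di N \<Longrightarrow> degree p \<le> N"
  and Di_end: "p \<in> polys_upto_Di N \<Longrightarrow> poly p 1 = 0" "p \<in> polys_upto_Di N \<Longrightarrow> poly p (-1) = 0"
  by (auto simp: polys_upto_Di_def polys_upto_def)

context
  fixes N :: nat
  assumes N: "1 \<le> N"
begin

lemma nodal_interp_Di: "nodal_interp N p \<in> polys_upto_Di N"
  unfolding nodal_interp_def by (rule LGL_interpolant[OF N])

lemma poly_nodal_interp: "\<xi> \<in> LGL_interior N \<Longrightarrow> poly (nodal_interp N p) \<xi> = poly p \<xi>"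
  unfolding nodal_interp_def by (rule LGL_interpolant[OF N])

lemma nodal_interp_id:
  assumes "p \<in> polys_upto_Di N"
  shows "nodal_interp N p = p"
  using nodal_interp_Di[of p] assms poly_nodal_interp
  by (intro poly_eq_on_nodes[OF N]) (auto simp: Di_degree Di_end LGL_nodes_cases)

lemma smult_linear_disc_lap: "smult_linear (disc_lap N)"
  by (simp add: smult_linear_def disc_lap_def nodal_interp_def pderiv_add pderiv_smult
      smult_add_left sum.distrib poly_vs.scale_sum_right)

lemma nodal_ip_quadrature:
  assumes "degree p + degree q \<le> 2 * N - 1"
  shows "nodal_ip N p q = poly_int (p * q)"
  using LGL_quadrature[OF N, of "p * q"] degree_mult_le[of p q] assms
  by (simp add: nodal_ip_def mult.assoc)

lemma nodal_ip_cong: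
  assumes "q \<in> polys_upto_Di N" "\<And>\<xi>. \<xi> \<in> LGL_interior N \<Longrightarrow> poly p \<xi> = poly p' \<xi>"
  shows "nodal_ip N p q = nodal_ip N p' q"
  unfolding nodal_ip_def using assms by (intro sum.cong) (auto simp: LGL_nodes_cases Di_end)

lemma nodal_ip_commute: "nodal_ip N p q = nodal_ip N q p"
  by (simp add: nodal_ip_def mult_ac)

lemma nodal_ip_interp: "q \<in> polys_upto_Di N \<Longrightarrow> nodal_ip N (nodal_interp N p) q = nodal_ip N p q"
  by (rule nodal_ip_cong) (simp_all add: poly_nodal_interp)

text \<open>The degrees are within reach of the quadrature, so both sides are integrals, related by
  two integrations by parts without end terms.\<close>

lemma nodal_ip_pderiv2:
  assumes p: "p \<in> polys_upto_Di N" and q: "q \<in> polys_upto_Di N"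
  shows "nodal_ip N (pderiv (pderiv p)) q = nodal_ip N p (pderiv (pderiv q))"
proof -
  have "nodal_ip N (pderiv (pderiv p)) q = poly_int (q * pderiv (pderiv p))"
    using Di_degree[OF p] Di_degree[OF q] N
    by (subst nodal_ip_quadrature) (simp_all add: degree_pderiv mult.commute)
  also have "\<dots> = poly_int (p * pderiv (pderiv q))"
    unfolding poly_int_by_parts[of q] poly_int_by_parts[of p]
    by (simp add: Di_end[OF p] Di_end[OF q] mult.commute)
  also have "\<dots> = nodal_ip N p (pderiv (pderiv q))"
    using Di_degree[OF p] Di_degree[OF q] N
    by (subst nodal_ip_quadrature) (simp_all add: degree_pderiv)
  finally show ?thesis .
qed

lemma disc_lap_adjoint:
  assumes "p \<in> polys_upto_Di N" "q \<in> polys_upto_Di N"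
  shows "nodal_ip N (disc_lap N p) q = nodal_ip N p (disc_lap N q)"
  unfolding disc_lap_def
  using assms nodal_ip_pderiv2 nodal_ip_interp nodal_ip_commute by metis

text \<open>After one integration by parts the product has degree at most 2N - 1, just within the
  exactness, and the quadrature of a basis polynomial times q' keeps only the node
  \<open>e\<close>.\<close>

lemma nodal_ip_pderiv_basis:
  assumes e: "e \<in> {-1, 1}" and q: "q \<in> polys_upto_Di N"
  shows "nodal_ip N (pderiv (LGL_basis N e)) q = - LGL_weight N e * poly (pderiv q) e"
proof -
  have eN: "e \<in> LGL_nodes N" using e LGL_end_nodes by auto
  have B: "degree (LGL_basis N e) \<le> N" using LGL_basis_in[OF N eN] by (simp add: polys_upto_def)
  have "nodal_ip N (pderiv (LGL_basis N e)) q = poly_int (q * pderiv (LGL_basis N e))"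
    using B Di_degree[OF q] N
    by (subst nodal_ip_quadrature) (simp_all add: degree_pderiv mult.commute)
  also have "\<dots> = - poly_int (LGL_basis N e * pderiv q)"
    unfolding poly_int_by_parts[of q] by (simp add: Di_end[OF q] mult.commute)
  also have "\<dots> = - nodal_ip N (LGL_basis N e) (pderiv q)"
    using B Di_degree[OF q] N by (subst nodal_ip_quadrature) (simp_all add: degree_pderiv)
  also have "nodal_ip N (LGL_basis N e) (pderiv q)
      = (\<Sum>\<xi>\<in>LGL_nodes N. if \<xi> = e then LGL_weight N e * poly (pderiv q) e else 0)"
    unfolding nodal_ip_def by (intro sum.cong) (auto simp: poly_LGL_basis[OF N])
  finally show ?thesis using eN finite_LGL_nodes[OF N] by simp
qed

text \<open>At the nodes \<open>h\<close> differs from the line (1 + e x)/2 only at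
  \<open>e\<close>, where it is 0 and not 1. The line contributes an exact integral, the difference
  the term with q''(e). Taking \<open>e\<close> as -1 or 1 treats \<open>hL\<close> and
  \<open>hR\<close> together.\<close>

lemma nodal_ip_pderiv2_lift:
  assumes e: "e \<in> {-1, 1}" and q: "q \<in> polys_upto_Di N" and h: "h \<in> polys_upto_Di N"
    "\<And>\<xi>. \<xi> \<in> LGL_interior N \<Longrightarrow> poly h \<xi> = (1 + e * \<xi>) / 2"
  shows "nodal_ip N (pderiv (pderiv h)) q
    = e * poly (pderiv q) e - LGL_weight N e * poly (pderiv (pderiv q)) e"
proof -
  let ?l = "[:1/2, e/2:]" and ?q2 = "pderiv (pderiv q)"
  have eN: "e \<in> LGL_nodes N" using e LGL_end_nodes by auto
  have "nodal_ip N (pderiv (pderiv h)) q = nodal_ip N h ?q2"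
    by (rule nodal_ip_pderiv2[OF h(1) q])
  also have "\<dots> = (\<Sum>\<xi>\<in>LGL_nodes N. LGL_weight N \<xi> * poly ?l \<xi> * poly ?q2 \<xi>
      - (if \<xi> = e then LGL_weight N e * poly ?q2 e else 0))"
    unfolding nodal_ip_def using e
    by (intro sum.cong)
       (auto simp: LGL_nodes_cases Di_end[OF h(1)] h(2) LGL_ends_notin_interior add_divide_distrib)
  also have "\<dots> = nodal_ip N ?l ?q2 - LGL_weight N e * poly ?q2 e"
    using eN finite_LGL_nodes[OF N] by (simp add: nodal_ip_def sum_subtractf)
  also have "nodal_ip N ?l ?q2 = poly_int (?l * ?q2)"
    using Di_degree[OF q] N by (intro nodal_ip_quadrature) (auto simp: degree_pderiv)
  also have "\<dots> = poly (?l * pderiv q) 1 - poly (?l * pderiv q) (-1) - poly_int (pderiv ?l * pderiv q)"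
    by (rule poly_int_by_parts)
  also have "pderiv ?l * pderiv q = smult (e / 2) (pderiv q)"
    by (simp add: pderiv_pCons)
  also have "poly_int \<dots> = 0"
    by (simp add: poly_int_smult poly_int_pderiv Di_end[OF q])
  also have "poly (?l * pderiv q) 1 - poly (?l * pderiv q) (-1) - 0 = e * poly (pderiv q) e"
    using e by auto
  finally show ?thesis .
qed

lemma nodal_ip_add_smult:
  "nodal_ip N (smult a p + smult b p') q = a * nodal_ip N p q + b * nodal_ip N p' q"
  by (simp add: nodal_ip_def sum.distrib sum_distrib_left algebra_simps)

text \<open>The two summands are scaled so that their contributions with q'(e) cancel and only
  q''(e) remains.\<close>

lemma nodal_ip_boundary_control:
  assumes e: "e \<in> {-1, 1}" and q: "q \<in> polys_upto_Di N" and h: "h \<in> polys_upto_Di N"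
    "\<And>\<xi>. \<xi> \<in> LGL_interior N \<Longrightarrow> poly h \<xi> = (1 + e * \<xi>) / 2"
    and w: "w = LGL_weight N e"
  shows "nodal_ip N (smult (1 / sqrt w) (pderiv (pderiv h))
      + smult (e / (sqrt w * w)) (pderiv (LGL_basis N e))) q
    = - (w / sqrt w) * poly (pderiv (pderiv q)) e"
proof -
  define s where "s = sqrt w"
  have "e \<in> LGL_nodes N" using e LGL_end_nodes by auto
  \<comment> \<open>The function \<open>sqrt\<close> is odd on the reals and vanishes only at 0, so
    a nonzero weight has a nonzero root.\<close>
  then have nz: "w \<noteq> 0" "s \<noteq> 0" using LGL_weight_nonzero[OF N] by (simp_all add: w s_def)
  have lift: "nodal_ip N (pderiv (pderiv h)) q = e * poly (pderiv q) e - w * poly (pderiv (pderiv q)) e"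
    unfolding w by (rule nodal_ip_pderiv2_lift[OF e q h])
  have basis: "nodal_ip N (pderiv (LGL_basis N e)) q = - w * poly (pderiv q) e"
    unfolding w by (rule nodal_ip_pderiv_basis[OF e q])
  show ?thesis
    unfolding nodal_ip_add_smult lift basis s_def[symmetric]
    using nz by (simp add: field_simps)
qed

lemma nodal_ip_GL:
  assumes q: "q \<in> polys_upto_Di N"
  shows "nodal_ip N (GL N) q
    = - (LGL_weight N (-1) / sqrt (LGL_weight N (-1))) * poly (pderiv (pderiv q)) (-1)"
  using nodal_ip_boundary_control[OF _ q hL_interpolates(1)[OF N], of "-1" "LGL_weight N (-1)"]
  by (simp add: GL_def Let_def hL_interpolates(2)[OF N])

lemma nodal_ip_GR:
  assumes q: "q \<in> polys_upto_Di N"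
  shows "nodal_ip N (GR N) q
    = - (LGL_weight N 1 / sqrt (LGL_weight N 1)) * poly (pderiv (pderiv q)) 1"
  using nodal_ip_boundary_control[OF _ q hR_interpolates(1)[OF N], of 1 "LGL_weight N 1"]
  by (simp add: GR_def Let_def hR_interpolates(2)[OF N])

section \<open>The Krylov spaces and their common annihilator\<close>

lemma krylov_Di: "krylov N b \<subseteq> polys_upto_Di N"
proof -
  have "(disc_lap N ^^ k) (nodal_interp N b) \<in> polys_upto_Di N" for k
    by (cases k) (simp_all add: nodal_interp_Di disc_lap_def)
  then show ?thesis by (auto simp: krylov_def)
qed

lemma krylov_interp: "nodal_interp N b \<in> krylov N b"
  using rangeI[of "\<lambda>k. (disc_lap N ^^ k) (nodal_interp N b)" 0] by (simp add: krylov_def)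

lemma krylov_disc_lap:
  assumes "p \<in> krylov N b"
  shows "disc_lap N p \<in> krylov N b"
proof -
  obtain k where "p = (disc_lap N ^^ k) (nodal_interp N b)"
    using assms unfolding krylov_def by (rule rangeE)
  then have "disc_lap N p = (disc_lap N ^^ Suc k) (nodal_interp N b)" by simp
  then show ?thesis unfolding krylov_def by (rule range_eqI)
qed

lemma Di_subset_span: "polys_upto_Di N \<subseteq> poly_vs.span (LGL_basis N ` LGL_nodes N)"
proof
  fix p assume "p \<in> polys_upto_Di N"
  then have "p = (\<Sum>\<xi>\<in>LGL_nodes N. smult (poly p \<xi>) (LGL_basis N \<xi>))"
    by (intro LGL_lagrange[OF N] Di_degree)
  also have "\<dots> \<in> poly_vs.span (LGL_basis N ` LGL_nodes N)"
    by (intro poly_vs.span_sum poly_vs.span_scale poly_vs.span_base imageI)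
  finally show "p \<in> poly_vs.span (LGL_basis N ` LGL_nodes N)" .
qed

text \<open>On the annihilator of both Krylov spaces the discrete Laplacian is the true second derivative,
  which lowers the degree.\<close>

lemma krylov_annihilator_trivial:
  assumes q: "q \<in> polys_upto_Di N" and ann: "\<And>p. p \<in> krylov N (GL N) \<union> krylov N (GR N) \<Longrightarrow> nodal_ip N p q = 0"
  shows "q = 0"
  using assms
proof (induction "degree q" arbitrary: q rule: less_induct)
  case less
  let ?q2 = "pderiv (pderiv q)"
  have w: "LGL_weight N (-1) \<noteq> 0" "LGL_weight N 1 \<noteq> 0"
    using LGL_weight_nonzero[OF N] LGL_end_nodes by simp_all
  have "nodal_ip N (GL N) q = 0" "nodal_ip N (GR N) q = 0"
    using less.prems(2)[of "nodal_interp N (GL N)"] less.prems(2)[of "nodal_interp N (GR N)"]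
    by (simp_all add: krylov_interp nodal_ip_interp less.prems(1))
  then have ends: "poly ?q2 (-1) = 0" "poly ?q2 1 = 0"
    using w by (simp_all add: nodal_ip_GL nodal_ip_GR less.prems(1))
  have "disc_lap N q = ?q2"
    unfolding disc_lap_def using ends less.prems(1)
    by (intro nodal_interp_id)
       (auto simp: polys_upto_Di_def polys_upto_def degree_pderiv)
  then have q2: "?q2 \<in> polys_upto_Di N" using nodal_interp_Di[of ?q2] by (simp add: disc_lap_def)
  have "?q2 = 0"
  \<comment> \<open>Differentiation lowers the degree strictly only for nonconstant
    \<open>q\<close>.\<close>
  proof (cases "degree q = 0")
    case True
    then show ?thesis by (simp add: pderiv_eq_0_iff[THEN iffD2])
  next
    case False
    show ?thesis
    proof (rule less.hyps[OF _ q2])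
      show "degree ?q2 < degree q" using False by (simp add: degree_pderiv)
      fix p assume p: "p \<in> krylov N (GL N) \<union> krylov N (GR N)"
      \<comment> \<open>Symmetry moves the discrete Laplacian onto \<open>p\<close>, and the Krylov
        spaces are invariant under it.\<close>
      then have "nodal_ip N p ?q2 = nodal_ip N (disc_lap N p) q"
        using disc_lap_adjoint[of p q] krylov_Di[of "GL N"] krylov_Di[of "GR N"] less.prems(1)
          \<open>disc_lap N q = ?q2\<close> by auto
      then show "nodal_ip N p ?q2 = 0"
        using p less.prems(2)[of "disc_lap N p"] krylov_disc_lap by auto
    qed
  qed
  then have "degree q \<le> 1" by (simp add: pderiv_eq_0_iff degree_pderiv)
  then have q: "q = [:coeff q 0, coeff q 1:]"
    by (intro poly_eqI) (auto simp: coeff_pCons coeff_eq_0 split: nat.split)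
  obtain a b where ab: "q = [:a, b:]" using q by (rule that)
  have "a + b = 0" "a - b = 0" using Di_end[OF less.prems(1)] by (simp_all add: ab)
  then have "a = 0" "b = 0" by linarith+
  then show ?case by (simp add: ab)
qed

text \<open>Duality: a functional separating \<open>x\<close> from the span would be represented by
  a common annihilator \<open>q\<close>, which is zero.\<close>

lemma Di_subset_krylov_span: "polys_upto_Di N \<subseteq> poly_vs.span (krylov N (GL N) \<union> krylov N (GR N))"
proof (rule subsetI, rule ccontr)
  let ?K = "krylov N (GL N) \<union> krylov N (GR N)"
  fix x assume x: "x \<in> polys_upto_Di N" and notin: "x \<notin> poly_vs.span ?K"
  obtain g where g: "(\<forall>p q. g (p + q) = g p + g q) \<and> (\<forall>c p. g (smult c p) = c * g p) \<and>
      (\<forall>p\<in>?K. g p = 0) \<and> g x = (1::real)"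
    using separating_functional[OF notin] by (elim exE)
  have add: "g (p + q) = g p + g q" and scale: "g (smult c p) = c * g p" for p q c
    using g by simp_all
  have gK: "g p = 0" if "p \<in> ?K" for p using g that by simp
  have gx: "g x = 1" using g by simp
  have g0: "g 0 = 0" using scale[of 0 0] by simp
  have g_sum: "g (\<Sum>\<xi>\<in>I. smult (c \<xi>) (f \<xi>)) = (\<Sum>\<xi>\<in>I. c \<xi> * g (f \<xi>))"
    for I :: "real set" and c f
    by (induction I rule: infinite_finite_induct) (simp_all add: g0 add scale)
  \<comment> \<open>The Riesz representative of \<open>g\<close> for the nodal pairing, whence the
    division by the weights.\<close>
  define q where "q = (\<Sum>\<xi>\<in>LGL_interior N. smult (g (LGL_basis N \<xi>) / LGL_weight N \<xi>) (LGL_basis N \<xi>))"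
  have q: "q \<in> polys_upto_Di N"
    "\<And>\<xi>. \<xi> \<in> LGL_interior N \<Longrightarrow> poly q \<xi> = g (LGL_basis N \<xi>) / LGL_weight N \<xi>"
    unfolding q_def by (rule LGL_interpolant[OF N])+
  have riesz: "g p = nodal_ip N p q" if p: "p \<in> polys_upto_Di N" for p
  proof -
    have "g p = (\<Sum>\<xi>\<in>LGL_nodes N. poly p \<xi> * g (LGL_basis N \<xi>))"
      by (subst LGL_lagrange[OF N Di_degree[OF p]]) (rule g_sum)
    also have "\<dots> = nodal_ip N p q"
      unfolding nodal_ip_def
    proof (intro sum.cong refl)
      fix \<xi> assume \<xi>: "\<xi> \<in> LGL_nodes N"
      then show "poly p \<xi> * g (LGL_basis N \<xi>) = LGL_weight N \<xi> * poly p \<xi> * poly q \<xi>"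
        using LGL_weight_nonzero[OF N \<xi>] Di_end[OF p] q(2) by (auto simp: LGL_nodes_cases)
    qed
    finally show ?thesis .
  qed
  have "q = 0"
    using q(1)
  proof (rule krylov_annihilator_trivial)
    fix p assume "p \<in> ?K"
    moreover from this have "p \<in> polys_upto_Di N"
      using krylov_Di[of "GL N"] krylov_Di[of "GR N"] by auto
    ultimately show "nodal_ip N p q = 0" using gK[of p] riesz[of p] by simp
  qed
  then have "g x = 0" using riesz[OF x] by (simp add: nodal_ip_def)
  then show False using gx by simp
qed

end

subsection \<open>Uniqueness of solutions\<close>

text \<open>The energy \<open>E\<close>, the sum of all squares of \<open>d\<close> and
  \<open>v\<close>, starts at zero and satisfies E' \<le> C E, so \<open>E\<close> times exp(-Ct)
  does not increase.\<close>

lemma second_order_gronwall: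
  fixes d v :: "'i \<Rightarrow> real \<Rightarrow> real" and D :: "'i \<Rightarrow> 'i \<Rightarrow> real"
  assumes fin: "finite I" and T: "0 \<le> T"
    and d': "\<And>i t. i \<in> I \<Longrightarrow> t \<in> {0..T} \<Longrightarrow> (d i has_real_derivative v i t) (at t within {0..T})"
    and d0: "\<And>i. i \<in> I \<Longrightarrow> d i 0 = 0"
    and v: "\<And>i t. i \<in> I \<Longrightarrow> t \<in> {0..T} \<Longrightarrow> ((\<lambda>s. \<Sum>j\<in>I. D i j * d j s) has_integral v i t) {0..t}"
    and i: "i \<in> I" and t: "t \<in> {0..T}"
  shows "d i t = 0 \<and> v i t = 0"
proof -
  have cont: "continuous_on {0..T} (\<lambda>s. \<Sum>j\<in>I. D i j * d j s)" for i
    using d' by (intro continuous_intros DERIV_continuous_on) blast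
  \<comment> \<open>The integrand is continuous, so \<open>v\<close> is classically differentiable
    on the closed interval.\<close>
  have v': "(v i has_real_derivative (\<Sum>j\<in>I. D i j * d j t)) (at t within {0..T})"
    if "i \<in> I" "t \<in> {0..T}" for i t
  proof (rule has_field_derivative_transform_within[OF _ zero_less_one that(2)])
    show "((\<lambda>t. integral {0..t} (\<lambda>s. \<Sum>j\<in>I. D i j * d j s)) has_real_derivative
        (\<Sum>j\<in>I. D i j * d j t)) (at t within {0..T})"
      by (rule integral_has_real_derivative[OF cont that(2)])
    show "integral {0..s} (\<lambda>s. \<Sum>j\<in>I. D i j * d j s) = v i s" if "s \<in> {0..T}" for s
      using v[OF \<open>i \<in> I\<close> that] by (rule integral_unique)
  qed
  have v0: "v i 0 = 0" if "i \<in> I" for i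
    using v[OF that, of 0] T by (simp add: has_integral_iff)
  define E where "E s = (\<Sum>i\<in>I. (d i s)\<^sup>2 + (v i s)\<^sup>2)" for s
  define E' where "E' s = (\<Sum>i\<in>I. 2 * d i s * v i s + 2 * v i s * (\<Sum>j\<in>I. D i j * d j s))" for s
  \<comment> \<open>The 1 absorbs the terms 2 d v, and each matrix entry absorbs one coupling term 2
    v_i D_ij d_j.\<close>
  define C where "C = 1 + (\<Sum>i\<in>I. \<Sum>j\<in>I. \<bar>D i j\<bar>)"
  have dE: "(E has_real_derivative E' s) (at s within {0..T})" if "s \<in> {0..T}" for s
    unfolding E_def[abs_def] E'_def using that
    by (auto intro!: derivative_eq_intros d' v' sum.cong)
  have part: "(d i s)\<^sup>2 \<le> E s \<and> (v i s)\<^sup>2 \<le> E s \<and> (i = j \<or> (v i s)\<^sup>2 + (d j s)\<^sup>2 \<le> E s) \<and> (d i s)\<^sup>2 + (v i s)\<^sup>2 \<le> E s"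
    if "i \<in> I" "j \<in> I" for i j s
  proof -
    have one: "(d i s)\<^sup>2 + (v i s)\<^sup>2 \<le> E s"
      unfolding E_def by (rule member_le_sum[OF that(1) _ fin]) simp
    have two: "(v i s)\<^sup>2 + (d j s)\<^sup>2 \<le> E s" if "i \<noteq> j"
    proof -
      have "(v i s)\<^sup>2 + (d j s)\<^sup>2 \<le> (\<Sum>k\<in>{i, j}. (d k s)\<^sup>2 + (v k s)\<^sup>2)"
        using that by simp
      also have "\<dots> \<le> E s"
        unfolding E_def using \<open>i \<in> I\<close> \<open>j \<in> I\<close> by (intro sum_mono2 fin) auto
      finally show ?thesis .
    qed
    show ?thesis using one two zero_le_power2[of "d i s"] zero_le_power2[of "v i s"] by linarith
  qed
  have E'_le: "E' s \<le> C * E s" for s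
  proof -
    have term_le: "2 * v i s * (D i j * d j s) \<le> \<bar>D i j\<bar> * E s" if "i \<in> I" "j \<in> I" for i j
    proof -
      have "2 * v i s * (D i j * d j s) \<le> \<bar>D i j\<bar> * \<bar>2 * v i s * d j s\<bar>"
        using abs_ge_self[of "2 * v i s * (D i j * d j s)"] by (simp add: abs_mult mult_ac)
      also have "\<bar>2 * v i s * d j s\<bar> \<le> (v i s)\<^sup>2 + (d j s)\<^sup>2"
        using sum_squares_bound[of "v i s" "d j s"] sum_squares_bound[of "- v i s" "d j s"]
        by (simp add: abs_if)
      also have "\<dots> \<le> E s" using part[OF that, of s] by (cases "i = j") (auto simp: add.commute)
      finally show ?thesis by (simp add: mult_left_mono)
    qed
    have "E' s \<le> (\<Sum>i\<in>I. ((d i s)\<^sup>2 + (v i s)\<^sup>2) + (\<Sum>j\<in>I. \<bar>D i j\<bar> * E s))"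
      unfolding E'_def
      by (intro sum_mono add_mono sum_squares_bound)
         (auto simp: sum_distrib_left intro!: sum_mono term_le)
    also have "\<dots> = C * E s"
      unfolding C_def distrib_right sum_distrib_right by (simp add: E_def sum.distrib)
    finally show ?thesis .
  qed
  define F where "F s = E s * exp (- C * s)" for s
  have "F t \<le> F 0"
  proof (rule DERIV_nonpos_imp_decreasing_open[of 0 t F])
    show "0 \<le> t" using t by simp
    show "\<exists>y. (F has_real_derivative y) (at s) \<and> y \<le> 0" if "0 < s" "s < t" for s
    proof (intro exI conjI)
      have "(E has_real_derivative E' s) (at s)"
        using dE[of s] that t by (simp add: at_within_Icc_at)
      then show "(F has_real_derivative (E' s - C * E s) * exp (- C * s)) (at s)"
        unfolding F_def[abs_def] by (auto intro!: derivative_eq_intros simp: algebra_simps)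
      show "(E' s - C * E s) * exp (- C * s) \<le> 0"
        using E'_le[of s] by (simp add: mult_nonpos_nonneg)
    qed
    have "continuous_on {0..T} E" using dE by (rule DERIV_continuous_on)
    then show "continuous_on {0..t} F"
      unfolding F_def[abs_def] using t
      by (intro continuous_intros) (auto elim: continuous_on_subset)
  qed
  also have "F 0 = 0" by (simp add: F_def E_def d0 v0)
  finally have "E t \<le> 0" by (simp add: F_def mult_le_0_iff not_le)
  moreover have "(d i t)\<^sup>2 \<le> E t" "(v i t)\<^sup>2 \<le> E t" using part[OF i i, of t] by auto
  ultimately have "(d i t)\<^sup>2 \<le> 0" "(v i t)\<^sup>2 \<le> 0" by linarith+
  then show ?thesis by simp
qed

lemma poly_L2_fun: "poly p \<in> L2_fun T"
proof -
  have cont: "continuous_on S (poly p)" "continuous_on S (\<lambda>t. (poly p t)\<^sup>2)" for S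
    by (intro continuous_intros)+
  have "set_integrable lebesgue {0..T} (\<lambda>t. (poly p t)\<^sup>2)"
    using absolutely_integrable_continuous[of 0 T "\<lambda>t. (poly p t)\<^sup>2"] cont(2) by simp
  then have "set_integrable lebesgue {0<..<T} (\<lambda>t. (poly p t)\<^sup>2)"
    by (rule set_integrable_subset) auto
  then show ?thesis
    unfolding L2_fun_def
    using continuous_imp_measurable_on_sets_lebesgue[OF cont(1), of "{0<..<T}"]
    by (simp add: integrable_restrict_space set_integrable_def)
qed

text \<open>The difference of two solutions obeys a homogeneous linear system for its interior nodal
  values. Boundary values are fixed only almost everywhere, so agreement is asserted at interior
  nodes.\<close>

lemma is_solution_unique:
  assumes N: "1 \<le> N" and T: "0 \<le> T"
    and u: "is_solution N T f gL gR u0 u1 u" and w: "is_solution N T f gL gR u0 u1 w"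
    and \<xi>: "\<xi> \<in> LGL_interior N" and t: "t \<in> {0..T}"
  shows "poly (u t) \<xi> = poly (w t) \<xi>"
proof -
  let ?I = "LGL_interior N"
  let ?F = "\<lambda>u \<xi> s. poly (pderiv (pderiv (u s))) \<xi> + gL s * poly (GL N) \<xi> + gR s * poly (GR N) \<xi>"
  let ?P = "\<lambda>u \<xi> v. v 0 = poly u1 \<xi> \<and> (\<forall>t\<in>{0..T}.
      ((\<lambda>s. poly (u s) \<xi>) has_real_derivative v t) (at t within {0..T}) \<and>
      (?F u \<xi> has_integral (v t - v 0)) {0..t})"
  have fin: "finite ?I" using finite_LGL_nodes[OF N] by (simp add: LGL_interior_def)
  define V where "V z \<xi> = (SOME v. ?P z \<xi> v)" for z \<xi>
  have V: "?P z \<xi> (V z \<xi>)" if z: "is_solution N T f gL gR u0 u1 z" and \<xi>: "\<xi> \<in> ?I" for z \<xi>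
  proof -
    have "\<forall>\<xi>\<in>?I. poly (z 0) \<xi> = poly u0 \<xi> \<and> (\<exists>v. ?P z \<xi> v)"
      using z unfolding is_solution_def by (elim conjE)
    from bspec[OF this \<xi>] have "\<exists>v. ?P z \<xi> v" by (rule conjunct2)
    then show ?thesis unfolding V_def by (rule someI_ex[where P="?P z \<xi>"])
  qed
  have "AE t in lebesgue_on {0<..<T}. poly (u t) 1 = f t \<and> poly (u t) (-1) = 0"
    "AE t in lebesgue_on {0<..<T}. poly (w t) 1 = f t \<and> poly (w t) (-1) = 0"
    using u w by (simp_all add: is_solution_def)
  then have "AE t in lebesgue_on {0<..<T}. poly (u t - w t) 1 = 0 \<and> poly (u t - w t) (-1) = 0"
    by eventually_elim simp
  then have "AE t in lebesgue. t \<in> {0<..<T} \<longrightarrow> poly (u t - w t) 1 = 0 \<and> poly (u t - w t) (-1) = 0"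
    by (subst (asm) AE_restrict_space_iff) auto
  then obtain M where M: "negligible M"
    "{t. \<not> (t \<in> {0<..<T} \<longrightarrow> poly (u t - w t) 1 = 0 \<and> poly (u t - w t) (-1) = 0)} \<subseteq> M"
    unfolding eventually_ae_filter_negligible by (elim exE conjE)
  define d where "d \<xi> s = poly (u s) \<xi> - poly (w s) \<xi>" for \<xi> s
  \<comment> \<open>Off the exceptional set, \<open>u s - w s\<close> vanishes at both ends and is
    the interpolant of its interior values; the control terms cancel. The times 0 and
    \<open>T\<close> are excluded because the boundary condition concerns the open interval.\<close>
  have expand: "(\<Sum>\<eta>\<in>?I. poly (pderiv (pderiv (LGL_basis N \<eta>))) \<xi> * d \<eta> s)
      = ?F u \<xi> s - ?F w \<xi> s" if s: "s \<in> {0..T} - (M \<union> {0, T})" for \<xi> s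
  proof -
    have "degree (u s) \<le> N" "degree (w s) \<le> N"
      using u[unfolded is_solution_def, THEN conjunct1] w[unfolded is_solution_def, THEN conjunct1] s
      by (simp_all add: polys_upto_def)
    moreover have "s \<in> {0<..<T} \<longrightarrow> poly (u s - w s) 1 = 0 \<and> poly (u s - w s) (-1) = 0"
      using M(2) s by blast
    with s have "poly (u s - w s) 1 = 0" "poly (u s - w s) (-1) = 0" by simp_all
    ultimately have "u s - w s \<in> polys_upto_Di N"
      by (auto simp: polys_upto_Di_def polys_upto_def degree_diff_le)
    from nodal_interp_id[OF N this]
    have "u s - w s = (\<Sum>\<eta>\<in>?I. smult (d \<eta> s) (LGL_basis N \<eta>))"
      by (simp add: nodal_interp_def d_def)
    then have "poly (pderiv (pderiv (u s - w s))) \<xi>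
        = poly (pderiv (pderiv (\<Sum>\<eta>\<in>?I. smult (d \<eta> s) (LGL_basis N \<eta>)))) \<xi>" by simp
    then show ?thesis
      by (simp add: pderiv_diff pderiv_smult higher_pderiv_sum[where n="Suc 0", simplified] poly_sum mult.commute)
  qed
  have "d \<xi> t = 0 \<and> V u \<xi> t - V w \<xi> t = 0"
  proof (rule second_order_gronwall[of ?I T d "\<lambda>\<xi> t. V u \<xi> t - V w \<xi> t"
        "\<lambda>\<xi> \<eta>. poly (pderiv (pderiv (LGL_basis N \<eta>))) \<xi>", OF fin T _ _ _ \<xi> t])
    fix \<eta> assume \<eta>: "\<eta> \<in> ?I"
    show "d \<eta> 0 = 0" using u w \<eta> by (simp add: is_solution_def d_def)
    fix s assume s: "s \<in> {0..T}"
    show "(d \<eta> has_real_derivative V u \<eta> s - V w \<eta> s) (at s within {0..T})"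
      unfolding d_def[abs_def] using V[OF u \<eta>] V[OF w \<eta>] s by (auto intro: DERIV_diff)
    have "((\<lambda>s. ?F u \<eta> s - ?F w \<eta> s) has_integral ((V u \<eta> s - V u \<eta> 0) - (V w \<eta> s - V w \<eta> 0))) {0..s}"
      using V[OF u \<eta>] V[OF w \<eta>] s by (intro has_integral_diff) auto
    moreover have "(V u \<eta> s - V u \<eta> 0) - (V w \<eta> s - V w \<eta> 0) = V u \<eta> s - V w \<eta> s"
      using V[OF u \<eta>] V[OF w \<eta>] by simp
    ultimately have "((\<lambda>s. ?F u \<eta> s - ?F w \<eta> s) has_integral (V u \<eta> s - V w \<eta> s)) {0..s}" by simp
    \<comment> \<open>Changing the integrand on a negligible set preserves the integral.\<close>
    then show "((\<lambda>s. \<Sum>\<zeta>\<in>?I. poly (pderiv (pderiv (LGL_basis N \<zeta>))) \<eta> * d \<zeta> s)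
        has_integral (V u \<eta> s - V w \<eta> s)) {0..s}"
    proof (rule has_integral_spike[rotated 2])
      show "negligible (M \<union> {0, T})" using M(1) by simp
      fix r assume "r \<in> {0..s} - (M \<union> {0, T})"
      then show "(\<Sum>\<zeta>\<in>?I. poly (pderiv (pderiv (LGL_basis N \<zeta>))) \<eta> * d \<zeta> r) = ?F u \<eta> r - ?F w \<eta> r"
        using s by (intro expand) simp
    qed
  qed
  then show ?thesis by (simp add: d_def)
qed

subsection \<open>Null controllability\<close>

text \<open>Krylov vectors vanish at both ends, so the steered trajectory meets the homogeneous
  boundary conditions at every time.\<close>

lemma krylov_steering:
  fixes T :: real
  assumes N: "1 \<le> N" and T: "T \<noteq> 0"
    and y: "y0 \<in> poly_vs.span (krylov N b)" "y1 \<in> poly_vs.span (krylov N b)"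
  shows "\<exists>z z' (g :: real poly).
    (\<forall>t x. ((\<lambda>s. poly (z s) x) has_real_derivative poly (z' t) x) (at t)) \<and>
    (\<forall>t x. ((\<lambda>s. poly (z' s) x) has_real_derivative
      poly (disc_lap N (z t) + smult (poly g t) (nodal_interp N b)) x) (at t)) \<and>
    z 0 = y0 \<and> z' 0 = y1 \<and> z T = 0 \<and> z' T = 0 \<and> (\<forall>t. z t \<in> polys_upto_Di N)"
proof -
  have K: "(disc_lap N ^^ k) (nodal_interp N b) \<in> krylov N b" for k
    unfolding krylov_def by (rule rangeI)
  have S: "(disc_lap N ^^ k) (nodal_interp N b) \<in> poly_vs.span (LGL_basis N ` LGL_nodes N)" for k
    using K[of k] krylov_Di[OF N, of b] Di_subset_span[OF N] by auto
  have fin: "finite (LGL_basis N ` LGL_nodes N)" using finite_LGL_nodes[OF N] by simp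
  have sub: "poly_vs.span (krylov N b) \<subseteq> polys_upto_Di N"
    by (intro poly_vs.span_minimal krylov_Di[OF N])
       (auto simp: poly_vs.subspace_def polys_upto_Di_def polys_upto_def degree_add_le
         intro: order_trans[OF degree_smult_le])
  show ?thesis
  proof (rule single_input_steering[OF smult_linear_disc_lap[OF N] fin S T y[unfolded krylov_def]])
    fix z z' g
    assume z: "\<And>t x. ((\<lambda>s. poly (z s) x) has_real_derivative poly (z' t) x) (at t)"
      and z': "\<And>t x. ((\<lambda>s. poly (z' s) x) has_real_derivative
        poly (disc_lap N (z t) + smult (poly g t) (nodal_interp N b)) x) (at t)"
      and ends: "z 0 = y0" "z' 0 = y1" "z T = 0" "z' T = 0"
      and K: "\<And>t. z t \<in> poly_vs.span (range (\<lambda>k. (disc_lap N ^^ k) (nodal_interp N b)))"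
    have "z t \<in> polys_upto_Di N" for t
      using K[of t] sub unfolding krylov_def by (rule rev_subsetD)
    then show ?thesis
      by (intro exI[of _ z] exI[of _ z'] exI[of _ g] conjI allI z z' ends)
  qed
qed

theorem theorem1:
  fixes N :: nat and T :: real and u0 u1 :: "real poly"
  assumes "N \<ge> 1"
    and "T > 4 * (2 + 1 / real N)"
    and "u0 \<in> polys_upto_Di N" and "u1 \<in> polys_upto_Di N"
  shows "\<exists>f \<in> L2_fun T. \<exists>gL \<in> L2_fun T. \<exists>gR \<in> L2_fun T.
           (\<exists>u. is_solution N T f gL gR u0 u1 u) \<and>
           (\<forall>u. is_solution N T f gL gR u0 u1 u \<longrightarrow>
              (\<forall>\<xi> \<in> LGL_interior N.
                 poly (u T) \<xi> = 0 \<and>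
                 ((\<lambda>t. poly (u t) \<xi>) has_real_derivative 0) (at T within {0..T})))"
proof -
  note N = assms(1)
  have T: "0 < T" using assms(2) by (smt (verit) of_nat_0_le_iff divide_nonneg_nonneg)
  have "u0 \<in> poly_vs.span (krylov N (GL N) \<union> krylov N (GR N))"
    and "u1 \<in> poly_vs.span (krylov N (GL N) \<union> krylov N (GR N))"
    using assms(3,4) Di_subset_krylov_span[OF N] by auto
  \<comment> \<open>Each datum is split between the two Krylov spaces; by linearity the two
    separately steered trajectories are then added.\<close>
  then have split: "\<exists>a b. u0 = a + b \<and> a \<in> poly_vs.span (krylov N (GL N)) \<and> b \<in> poly_vs.span (krylov N (GR N))"
    "\<exists>a b. u1 = a + b \<and> a \<in> poly_vs.span (krylov N (GL N)) \<and> b \<in> poly_vs.span (krylov N (GR N))"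
    unfolding poly_vs.span_Un mem_Collect_eq .
  from split(1) obtain a b where a: "u0 = a + b" "a \<in> poly_vs.span (krylov N (GL N))"
    "b \<in> poly_vs.span (krylov N (GR N))" by (elim exE conjE)
  from split(2) obtain a' b' where a': "u1 = a' + b'" "a' \<in> poly_vs.span (krylov N (GL N))"
    "b' \<in> poly_vs.span (krylov N (GR N))" by (elim exE conjE)
  note ab = a(1) a'(1) and L = a(2) a'(2) and R = a(3) a'(3)
  have T': "T \<noteq> 0" using T by simp
  obtain x x' gL where x_all:
    "(\<forall>t c. ((\<lambda>s. poly (x s) c) has_real_derivative poly (x' t) c) (at t)) \<and>
    (\<forall>t c. ((\<lambda>s. poly (x' s) c) has_real_derivative
      poly (disc_lap N (x t) + smult (poly gL t) (nodal_interp N (GL N))) c) (at t)) \<and>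
    x 0 = a \<and> x' 0 = a' \<and> x T = 0 \<and> x' T = 0 \<and> (\<forall>t. x t \<in> polys_upto_Di N)"
    using krylov_steering[OF N T' L] by (elim exE)
  have x: "((\<lambda>s. poly (x s) c) has_real_derivative poly (x' t) c) (at t)"
    and x': "((\<lambda>s. poly (x' s) c) has_real_derivative
      poly (disc_lap N (x t) + smult (poly gL t) (nodal_interp N (GL N))) c) (at t)"
    and xDi: "x t \<in> polys_upto_Di N" for t c
    using x_all by simp_all
  have xe: "x 0 = a" "x' 0 = a'" "x T = 0" "x' T = 0" using x_all by simp_all
  obtain y y' gR where y_all:
    "(\<forall>t c. ((\<lambda>s. poly (y s) c) has_real_derivative poly (y' t) c) (at t)) \<and>
    (\<forall>t c. ((\<lambda>s. poly (y' s) c) has_real_derivative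
      poly (disc_lap N (y t) + smult (poly gR t) (nodal_interp N (GR N))) c) (at t)) \<and>
    y 0 = b \<and> y' 0 = b' \<and> y T = 0 \<and> y' T = 0 \<and> (\<forall>t. y t \<in> polys_upto_Di N)"
    using krylov_steering[OF N T' R] by (elim exE)
  have y: "((\<lambda>s. poly (y s) c) has_real_derivative poly (y' t) c) (at t)"
    and y': "((\<lambda>s. poly (y' s) c) has_real_derivative
      poly (disc_lap N (y t) + smult (poly gR t) (nodal_interp N (GR N))) c) (at t)"
    and yDi: "y t \<in> polys_upto_Di N" for t c
    using y_all by simp_all
  have ye: "y 0 = b" "y' 0 = b'" "y T = 0" "y' T = 0" using y_all by simp_all
  define z where "z t = x t + y t" for t
  define z' where "z' t = x' t + y' t" for t
  have z: "((\<lambda>s. poly (z s) c) has_real_derivative poly (z' t) c) (at t)" for t c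
    unfolding z_def z'_def poly_add by (rule DERIV_add[OF x y])
  \<comment> \<open>Evaluation at an interior node removes the interpolation, which leaves the
    original equation with \<open>GL\<close> and \<open>GR\<close>.\<close>
  have z': "((\<lambda>s. poly (z' s) \<xi>) has_real_derivative poly (pderiv (pderiv (z t))) \<xi>
      + poly gL t * poly (GL N) \<xi> + poly gR t * poly (GR N) \<xi>) (at t)"
    if "\<xi> \<in> LGL_interior N" for t \<xi>
    using DERIV_add[OF x'[of \<xi> t] y'[of \<xi> t]] that
    by (simp add: z_def z'_def disc_lap_def poly_nodal_interp[OF N] pderiv_add algebra_simps)
  have zDi: "degree (z t) \<le> N" "poly (z t) 1 = 0" "poly (z t) (-1) = 0" for t
    using xDi[of t] yDi[of t] by (auto simp: z_def polys_upto_Di_def polys_upto_def degree_add_le)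
  have sol: "is_solution N T (poly 0) (poly gL) (poly gR) u0 u1 z"
    unfolding is_solution_def
  proof (intro conjI ballI)
    fix \<xi> assume \<xi>: "\<xi> \<in> LGL_interior N"
    show "poly (z 0) \<xi> = poly u0 \<xi>" by (simp add: z_def ab xe ye)
    show "\<exists>v. v 0 = poly u1 \<xi> \<and> (\<forall>t\<in>{0..T}.
        ((\<lambda>s. poly (z s) \<xi>) has_real_derivative v t) (at t within {0..T}) \<and>
        ((\<lambda>s. poly (pderiv (pderiv (z s))) \<xi> + poly gL s * poly (GL N) \<xi> + poly gR s * poly (GR N) \<xi>)
          has_integral (v t - v 0)) {0..t})"
    proof (intro exI[of _ "\<lambda>t. poly (z' t) \<xi>"] conjI ballI)
      show "poly (z' 0) \<xi> = poly u1 \<xi>" by (simp add: z'_def ab xe ye)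
      fix t assume t: "t \<in> {0..T}"
      show "((\<lambda>s. poly (z s) \<xi>) has_real_derivative poly (z' t) \<xi>) (at t within {0..T})"
        by (rule DERIV_subset[OF z]) simp
      show "((\<lambda>s. poly (pderiv (pderiv (z s))) \<xi> + poly gL s * poly (GL N) \<xi> + poly gR s * poly (GR N) \<xi>)
          has_integral (poly (z' t) \<xi> - poly (z' 0) \<xi>)) {0..t}"
      proof (rule fundamental_theorem_of_calculus)
        show "0 \<le> t" using t by simp
        show "((\<lambda>s. poly (z' s) \<xi>) has_vector_derivative poly (pderiv (pderiv (z s))) \<xi>
            + poly gL s * poly (GL N) \<xi> + poly gR s * poly (GR N) \<xi>) (at s within {0..t})" for s
          unfolding has_real_derivative_iff_has_vector_derivative[symmetric]
          by (rule DERIV_subset[OF z'[OF \<xi>]]) simp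
      qed
    qed
  qed (simp_all add: zDi polys_upto_def)
  show ?thesis
  proof (rule bexI[OF _ poly_L2_fun], rule bexI[OF _ poly_L2_fun], rule bexI[OF _ poly_L2_fun],
      intro conjI exI allI impI ballI)
    show "is_solution N T (poly 0) (poly gL) (poly gR) u0 u1 z" by (rule sol)
    fix u \<xi>
    assume u: "is_solution N T (poly 0) (poly gL) (poly gR) u0 u1 u" and \<xi>: "\<xi> \<in> LGL_interior N"
    \<comment> \<open>Any solution agrees with \<open>z\<close> at the interior nodes on all of
      [0, T], so both its value and its one-sided derivative at \<open>T\<close> are those of
      \<open>z\<close>.\<close>
    have eq: "poly (u t) \<xi> = poly (z t) \<xi>" if "t \<in> {0..T}" for t
      using is_solution_unique[OF N _ u sol \<xi> that] T by simp
    show "poly (u T) \<xi> = 0" using eq[of T] T by (simp add: z_def xe ye)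
    have "((\<lambda>t. poly (z t) \<xi>) has_real_derivative 0) (at T within {0..T})"
      using DERIV_subset[OF z[of \<xi> T], of "{0..T}"] by (simp add: z'_def xe ye)
    then show "((\<lambda>t. poly (u t) \<xi>) has_real_derivative 0) (at T within {0..T})"
      by (rule has_field_derivative_transform_within[OF _ zero_less_one]) (use T eq in auto)
  qed
qed

end
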